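(* Let $\mathbf M=\langle M;G_1,R_1\rangle$ and $\mathbf N=\langle N;G^\nu,R^\nu\rangle$ be non-trivial total structures (not necessarily of the same type) and let $\widetilde{\mathbf M}=\langle M;G_2,R_2,\mathcal T\rangle$ and $\widetilde{\mathbf N}$ be total structures with topology that are alter egos of $\mathbf M$ and $\mathbf N$, respectively. Put $\mathcal A=\mathbb{ISP}(\mathbf M)$, $\mathcal X=\mathbb{IS}_c\mathbb P^+(\widetilde{\mathbf M})$, $\mathcal B=\mathbb{ISP}(\mathbf N)$, $\mathcal Y=\mathbb{IS}_c\mathbb P^+(\widetilde{\mathbf N})$. Assume that $\widetilde{\mathbf N}$ fully dualises $\mathbf N$, that $\widetilde{\mathbf N}$ is injective in $\mathcal Y$, that $\mathbf N$ is injective in $\mathcal B$, and that $\widetilde{\mathbf M}$ has named constants. Assume that $\widetilde{\mathbf M}$ has a structural reduct $\widetilde{\mathbf M}^\flat$ in $\mathcal Y$ and let $\Omega\subseteq\mathcal Y(\widetilde{\mathbf M}^\flat,\widetilde{\mathbf N})$. Then $\widetilde{\mathbf M}$ co-dualises $\mathbf M$ provided at least one of the following alternatives (S), (G) holds. (S) $\Omega=\{\omega\}$ is a singleton and all of the following hold: (1) $\omega\circ\mathrm{Clo}_1(\mathbf M)$ separates the structure $\widetilde{\mathbf M}^\flat$; (2) (i) $\mathbf N$ is purely relational, or (ii) $\mathbf M$ has a structural reduct $\mathbf M^\flat$ in $\mathcal B$ such that $\omega\in\mathcal B(\mathbf M^\flat,\mathbf N)$; (3) (i) (a) the operations in $G_2$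 are continuous, and (b) $\mathbf M$ entails every relation in $\max_{\widetilde{\mathbf M}}\{\omega\}^{-1}(r)$, for each $r\in R^\nu$; and (ii) either (a) $\mathbf M$ entails each binary relation on $M$ which forms a substructure of $\widetilde{\mathbf M}^2$ that is maximal in $\ker(\omega)$, or (b) $\omega\circ\mathrm{Clo}_1(\widetilde{\mathbf M})$ separates the points of $M$. (G) All of the following hold: (1) $\Omega\circ\mathrm{Clo}_1(\mathbf M)$ separates the structure $\widetilde{\mathbf M}^\flat$; (2) (i) $\mathbf N$ is purely relational, or (ii) $\mathbf M$ has a structural reduct $\mathbf M^\flat$ in $\mathcal B$, each $\omega\in\Omega$ belongs to $\mathcal B(\mathbf M^\flat,\mathbf N)$, and every operation in $G^\nu$ is unary or nullary; (3) (i) (a) the operations in $G_2$ are continuous, and (b) $\mathbf M$ entails every relation in $\max_{\widetilde{\mathbf M}}\Omega^{-1}(r)$, for each $r\in R^\nu$; and (ii) $\mathbf M$ entails every relation in $\max_{\widetilde{\mathbf M}}\Omega^{-1}(\Delta_N)$.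
   Context: **Structures.** A total structure is $\mathbf M=\langle M;G,R\rangle$ with $M$ a non-empty set, $G$ a set of finitary operations (nullary allowed) and $R$ a set of finitary non-empty relations on $M$; $G$ or $R$ may be empty. It is a total algebra if $R=\varnothing$ and purely relational if $G=\varnothing$; non-trivial means having more than one element. Operations and relations are lifted pointwise to powers. A substructure ($\le$) is a subset closed under the operations, with the restricted relations; substructures of structures without topology are non-empty. Homomorphisms preserve all operations and relations. A total structure with topology $\widetilde{\mathbf M}=\langle M;G,R,\mathcal T\rangle$ also carries a compact Hausdorff topology $\mathcal T$ on $M$ (no compatibility of structure and topology is assumed); purely structural notions applied to $\widetilde{\mathbf M}$ (term functions, substructures of $\widetilde{\mathbf M}^n$, separation of the structure, etc.) refer to the structure with the topology removed. $\widetilde{\mathbf M}$ has named constants if the value of every constant unary term function is the value of a nullary term function. **Classes.** $\mathbb{ISP}(\mathbf M)$ is the category of all (non-empty) structures isomorphic to substructures of powers of $\mathbf M$, with homomorphisms as morphisms. $\mathbb{IS}_c\mathbb P^+(\widetilde{\mathbf M})$ is the category of all structures with topology isomorphic to topologically closed substructures of powers $\widetilde{\mathbf M}^S$ with $S\neq\varnothing$ (product topology), with continuous homomorphisms as morphisms; the empty structure belongs to it if the type of $\widetilde{\mathbf M}$ has no nullary operations. $\mathcal C(\mathbf A,\mathbf B)$ denotes the set of morphisms in a category $\mathcal C$. Embeddings are isomorphisms onto substructures in $\mathbb{ISP}(\mathbf M)$ and isomorphisms onto topologically closed substructures in $\mathbb{IS}_c\mathbb P^+(\widetilde{\mathbf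 M})$; injectivity is with respect to these embeddings. **Alter egos.** $\widetilde{\mathbf M}=\langle M;G_2,R_2,\mathcal T\rangle$ is an alter ego of $\mathbf M=\langle M;G_1,R_1\rangle$ if each $n$-ary $r\in R_2$ forms a substructure of $\mathbf M^n$, each $n$-ary $g\in G_2$ is a homomorphism $\mathbf M^n\to\mathbf M$, each relation in $R_1$ is topologically closed and each operation in $G_1$ is continuous with respect to $\mathcal T$. **Dualities.** Let $\widetilde{\mathbf M}$ be an alter ego of $\mathbf M$, $\mathcal A=\mathbb{ISP}(\mathbf M)$, $\mathcal X=\mathbb{IS}_c\mathbb P^+(\widetilde{\mathbf M})$. For $\mathbf A\in\mathcal A$, $\mathcal A(\mathbf A,\mathbf M)$ is a closed substructure of $\widetilde{\mathbf M}^A$, giving $\mathrm D(\mathbf A)\in\mathcal X$; for $\mathbf X\in\mathcal X$, $\mathcal X(\mathbf X,\widetilde{\mathbf M})$ is a substructure of $\mathbf M^X$, giving $\mathrm E(\mathbf X)\in\mathcal A$. The evaluation maps are $e_{\mathbf A}\colon\mathbf A\to\mathrm{ED}(\mathbf A)$, $e_{\mathbf A}(a)(x)=x(a)$, and $\varepsilon_{\mathbf X}\colon\mathbf X\to\mathrm{DE}(\mathbf X)$, $\varepsilon_{\mathbf X}(x)(\alpha)=\alpha(x)$. $\widetilde{\mathbf M}$ dualises $\mathbf M$ if $e_{\mathbf A}$ is an isomorphism for all $\mathbf A\in\mathcal A$; it co-dualises $\mathbf M$ if $\varepsilon_{\mathbf X}$ is an isomorphism for all $\mathbf X\in\mathcal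 X$; it fully dualises $\mathbf M$ if both hold. **Term functions and separation.** $\mathrm{Clo}_1(\cdot)$ is the set of unary term functions. For sets of maps, $\Omega\circ\mathcal E=\{\omega\circ u\mid\omega\in\Omega,u\in\mathcal E\}$, and $\omega\circ\mathcal E=\{\omega\}\circ\mathcal E$. A set $Z$ of maps from $A$ to $N$ separates the points of $A$ if for all $a\ne b$ in $A$ some $z\in Z$ has $z(a)\neq z(b)$; it separates the structure $\mathbf A$ (where $\mathbf A$ and the structure on $N$ have the same type) if it separates the points and, for every $n$-ary relation symbol $r$ of the type and $(a_1,\dots,a_n)\notin r$ in $\mathbf A$, some $z\in Z$ has $(z(a_1),\dots,z(a_n))\notin r$ in $N$. (For $\widetilde{\mathbf M}^\flat$ the relations on $N$ are those of $\widetilde{\mathbf N}$.) **Structural reducts.** $\langle M;G',R'\rangle$ is a structural reduct of $\langle M;G,R\rangle$ if each operation in $G'$ is a term function of $\langle M;G,R\rangle$ (a nullary term function if nullary) and each relation in $R'$ is conjunct-atomic definable, i.e. is the set of tuples satisfying a finite conjunction of atomic formulas in the language $\langle G,R\rangle$ (with equality). "$\mathbf M$ has a structural reduct $\mathbf M^\flat$ in $\mathcal B=\mathbb{ISP}(\mathbf N)$" means $\mathbf M^\flat$ is a structural reduct of the type of $\mathbf N$ with $\mathbf M^\flat\in\mathcal B$. "$\widetilde{\mathbf M}$ has a structural reduct $\widetilde{\mathbf M}^\flat$ in $\mathcal Y=\mathbb{IS}_c\mathbb P^+(\widetilde{\mathbf N})$" means that $\widetilde{\mathbf M}^\flat$,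 of the type of $\widetilde{\mathbf N}$ and with the same topology as $\widetilde{\mathbf M}$, has underlying structure a structural reduct of that of $\widetilde{\mathbf M}$, and $\widetilde{\mathbf M}^\flat\in\mathcal Y$. **Maximal relations and entailment.** For $r\subseteq N^n$ and $\omega_1,\dots,\omega_n\colon M\to N$, $(\omega_1,\dots,\omega_n)^{-1}(r)=\{(a_1,\dots,a_n)\in M^n\mid(\omega_1(a_1),\dots,\omega_n(a_n))\in r\}$. For $\Omega\subseteq N^M$, $\max_{\widetilde{\mathbf M}}\Omega^{-1}(r)$ is the set of all $s\subseteq M^n$ forming a substructure of $\langle M;G_2,R_2\rangle^n$ that is maximal (among substructures) in $(\omega_1,\dots,\omega_n)^{-1}(r)$ for some $\omega_1,\dots,\omega_n\in\Omega$. $\Delta_N=\{(a,a)\mid a\in N\}$ and $\ker(\omega)=(\omega,\omega)^{-1}(\Delta_N)$. $\mathbf M$ entails $r\subseteq M^n$ if $r$ forms a topologically closed substructure of $\widetilde{\mathbf M}^n$ and, for all $\mathbf X\in\mathcal X$, every $\mathcal A$-morphism $u\colon\mathcal X(\mathbf X,\widetilde{\mathbf M})\to\mathbf M$ preserves $r$ (lifted pointwise to $\mathcal X(\mathbf X,\widetilde{\mathbf M})$).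
   Formalization: The empty set is counted as a substructure in the maximal relations when G₂ has no nullary operations, so M must entail ∅ where it is maximal; without this the claim fails at the empty structure X = ∅. *)

theory Defs
  imports "HOL-Analysis.Analysis"
begin

section \<open>Structures\<close>

text \<open>
  The type (signature) of a structure consists of operation and relation symbols with arities.
  The operations and relations of a structure are families indexed by these symbols; a set of
  operations or relations is such a family, indexed by itself. An \<open>n\<close>-tuple is a list of
  length \<open>n\<close>. Values of \<open>opn\<close> and \<open>rel\<close> at symbols outside the type are irrelevant.
\<close>

record ('f, 'r) signature =
  opsyms :: "'f set"
  opar :: "'f \<Rightarrow> nat"
  relsyms :: "'r set"
  relar :: "'r \<Rightarrow> nat"

record ('a, 'f, 'r) relstruct =
  sig :: "('f, 'r) signature"
  carrier :: "'a set"
  opn :: "'f \<Rightarrow> 'a list \<Rightarrow> 'a"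
  rel :: "'r \<Rightarrow> 'a list set"

text \<open>
  A structure with topology extends a structure. Every notion below that is declared on
  \<open>relstruct_scheme\<close> ignores the topology.
\<close>

record ('a, 'f, 'r) topstruct = "('a, 'f, 'r) relstruct" +
  topol :: "'a topology"

definition tuples :: "'a set \<Rightarrow> nat \<Rightarrow> 'a list set" where
  "tuples A n = {xs. length xs = n \<and> set xs \<subseteq> A}"

definition is_struct :: "('a, 'f, 'r, 'z) relstruct_scheme \<Rightarrow> bool" where
  "is_struct A \<longleftrightarrow>
     (\<forall>f\<in>opsyms (sig A). \<forall>xs\<in>tuples (carrier A) (opar (sig A) f). opn A f xs \<in> carrier A) \<and>
     (\<forall>r\<in>relsyms (sig A). rel A r \<subseteq> tuples (carrier A) (relar (sig A) r))"

definition total_structure :: "('a, 'f, 'r, 'z) relstruct_scheme \<Rightarrow> bool" where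
  "total_structure A \<longleftrightarrow>
     is_struct A \<and> carrier A \<noteq> {} \<and> (\<forall>r\<in>relsyms (sig A). rel A r \<noteq> {})"

definition total_topstruct :: "('a, 'f, 'r) topstruct \<Rightarrow> bool" where
  "total_topstruct X \<longleftrightarrow>
     total_structure X \<and> topspace (topol X) = carrier X \<and>
     compact_space (topol X) \<and> Hausdorff_space (topol X)"

definition nontrivial :: "('a, 'f, 'r, 'z) relstruct_scheme \<Rightarrow> bool" where
  "nontrivial A \<longleftrightarrow> (\<exists>a\<in>carrier A. \<exists>b\<in>carrier A. a \<noteq> b)"

definition purely_relational :: "('a, 'f, 'r, 'z) relstruct_scheme \<Rightarrow> bool" where
  "purely_relational A \<longleftrightarrow> opsyms (sig A) = {}"

text \<open>
  The empty set is a subuniverse if and only if there are no nullary operations; where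
  substructures are required to be non-empty this is stated separately.
\<close>

definition subuniverse :: "('a, 'f, 'r, 'z) relstruct_scheme \<Rightarrow> 'a set \<Rightarrow> bool" where
  "subuniverse A B \<longleftrightarrow> B \<subseteq> carrier A \<and>
     (\<forall>f\<in>opsyms (sig A). \<forall>xs\<in>tuples B (opar (sig A) f). opn A f xs \<in> B)"

definition substr ::
  "('a, 'f, 'r, 'z) relstruct_scheme \<Rightarrow> 'a set \<Rightarrow> ('a, 'f, 'r, 'z) relstruct_scheme" where
  "substr A B = A\<lparr>carrier := B, rel := (\<lambda>r. {xs \<in> rel A r. set xs \<subseteq> B})\<rparr>"

definition tsubstr :: "('a, 'f, 'r) topstruct \<Rightarrow> 'a set \<Rightarrow> ('a, 'f, 'r) topstruct" where
  "tsubstr X B = (substr X B)\<lparr>topol := subtopology (topol X) B\<rparr>"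

definition power_str ::
  "('a, 'f, 'r, 'z) relstruct_scheme \<Rightarrow> 'i set \<Rightarrow> ('i \<Rightarrow> 'a, 'f, 'r) relstruct" where
  "power_str A S =
     \<lparr>sig = sig A,
      carrier = S \<rightarrow>\<^sub>E carrier A,
      opn = (\<lambda>f xs. \<lambda>s\<in>S. opn A f (map (\<lambda>x. x s) xs)),
      rel = (\<lambda>r. {xs \<in> tuples (S \<rightarrow>\<^sub>E carrier A) (relar (sig A) r).
                    \<forall>s\<in>S. map (\<lambda>x. x s) xs \<in> rel A r})\<rparr>"

definition power_top :: "('a, 'f, 'r) topstruct \<Rightarrow> 'i set \<Rightarrow> ('i \<Rightarrow> 'a, 'f, 'r) topstruct" where
  "power_top X S =
     \<lparr>sig = sig X,
      carrier = carrier (power_str X S),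
      opn = opn (power_str X S),
      rel = rel (power_str X S),
      topol = product_topology (\<lambda>_. topol X) S\<rparr>"

text \<open>Finite powers, with elements presented as tuples rather than as functions.\<close>

definition npower ::
  "('a, 'f, 'r, 'z) relstruct_scheme \<Rightarrow> nat \<Rightarrow> ('a list, 'f, 'r) relstruct" where
  "npower A n =
     \<lparr>sig = sig A,
      carrier = tuples (carrier A) n,
      opn = (\<lambda>f xss. map (\<lambda>i. opn A f (map (\<lambda>xs. xs ! i) xss)) [0..<n]),
      rel = (\<lambda>r. {xss \<in> tuples (tuples (carrier A) n) (relar (sig A) r).
                    \<forall>i<n. map (\<lambda>xs. xs ! i) xss \<in> rel A r})\<rparr>"

definition tuple_topology :: "'a topology \<Rightarrow> nat \<Rightarrow> 'a list topology" where
  "tuple_topology T n =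
     pullback_topology (tuples (topspace T) n) (\<lambda>xs. \<lambda>i\<in>{..<n}. xs ! i)
       (product_topology (\<lambda>_. T) {..<n})"


section \<open>Morphisms\<close>

definition hom ::
  "('a, 'f, 'r, 'z) relstruct_scheme \<Rightarrow> ('b, 'f, 'r, 'w) relstruct_scheme \<Rightarrow> ('a \<Rightarrow> 'b) set" where
  "hom A B = {h \<in> carrier A \<rightarrow>\<^sub>E carrier B.
     (\<forall>f\<in>opsyms (sig A). \<forall>xs\<in>tuples (carrier A) (opar (sig A) f).
        h (opn A f xs) = opn B f (map h xs)) \<and>
     (\<forall>r\<in>relsyms (sig A). \<forall>xs\<in>rel A r. map h xs \<in> rel B r)}"

definition chom :: "('a, 'f, 'r) topstruct \<Rightarrow> ('b, 'f, 'r) topstruct \<Rightarrow> ('a \<Rightarrow> 'b) set" where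
  "chom X Y = {h \<in> hom X Y. continuous_map (topol X) (topol Y) h}"

definition isomorphism ::
  "('a, 'f, 'r, 'z) relstruct_scheme \<Rightarrow> ('b, 'f, 'r, 'w) relstruct_scheme \<Rightarrow> ('a \<Rightarrow> 'b) \<Rightarrow> bool"
  where
  "isomorphism A B h \<longleftrightarrow> h \<in> hom A B \<and>
     (\<exists>k\<in>hom B A. (\<forall>a\<in>carrier A. k (h a) = a) \<and> (\<forall>b\<in>carrier B. h (k b) = b))"

definition top_isomorphism ::
  "('a, 'f, 'r) topstruct \<Rightarrow> ('b, 'f, 'r) topstruct \<Rightarrow> ('a \<Rightarrow> 'b) \<Rightarrow> bool" where
  "top_isomorphism X Y h \<longleftrightarrow> h \<in> chom X Y \<and>
     (\<exists>k\<in>chom Y X. (\<forall>a\<in>carrier X. k (h a) = a) \<and> (\<forall>b\<in>carrier Y. h (k b) = b))"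

definition embedding ::
  "('a, 'f, 'r) relstruct \<Rightarrow> ('b, 'f, 'r) relstruct \<Rightarrow> ('a \<Rightarrow> 'b) \<Rightarrow> bool" where
  "embedding A B h \<longleftrightarrow>
     (\<exists>C. C \<noteq> {} \<and> subuniverse B C \<and> isomorphism A (substr B C) h)"

definition top_embedding ::
  "('a, 'f, 'r) topstruct \<Rightarrow> ('b, 'f, 'r) topstruct \<Rightarrow> ('a \<Rightarrow> 'b) \<Rightarrow> bool" where
  "top_embedding X Y h \<longleftrightarrow>
     (\<exists>C. closedin (topol Y) C \<and> subuniverse Y C \<and> top_isomorphism X (tsubstr Y C) h)"


section \<open>The classes \<open>ISP\<close> and \<open>IS\<^sub>cP\<^sup>+\<close>\<close>

text \<open>
  The exponent of the power is taken to be a set of maps from the structure into the generator.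
  This is no restriction: an isomorphism \<open>h\<close> onto a substructure of a power with exponent
  \<open>S\<close> of any type may be re-indexed by the set of all \<open>\<pi>\<^sub>s \<circ> h\<close> with \<open>s \<in> S\<close>; see
  \<open>ISP_any_exponent\<close> and \<open>IScP_any_exponent\<close> below.
\<close>

definition ISP :: "('m, 'f, 'r) relstruct \<Rightarrow> ('a, 'f, 'r) relstruct set" where
  "ISP M = {A. sig A = sig M \<and> is_struct A \<and>
     (\<exists>(S :: ('a \<Rightarrow> 'm) set) B h. B \<noteq> {} \<and> subuniverse (power_str M S) B \<and>
        isomorphism A (substr (power_str M S) B) h)}"

text \<open>
  Here \<open>B\<close> may be empty, which happens exactly if there are no nullary operations. So the
  empty structure with topology is included in that case.
\<close>

definition IScP :: "('m, 'f, 'r) topstruct \<Rightarrow> ('x, 'f, 'r) topstruct set" where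
  "IScP M = {X. sig X = sig M \<and> is_struct X \<and> topspace (topol X) = carrier X \<and>
     (\<exists>(S :: ('x \<Rightarrow> 'm) set) B h. S \<noteq> {} \<and> closedin (topol (power_top M S)) B \<and>
        subuniverse (power_top M S) B \<and> top_isomorphism X (tsubstr (power_top M S) B) h)}"

lemma power_str_simps:
  "sig (power_str M S) = sig M" "carrier (power_str M S) = S \<rightarrow>\<^sub>E carrier M"
  by (simp_all add: power_str_def)

lemma substr_simps:
  "sig (substr A B) = sig A" "carrier (substr A B) = B" "opn (substr A B) = opn A"
  "xs \<in> rel (substr A B) r \<longleftrightarrow> xs \<in> rel A r \<and> set xs \<subseteq> B"
  by (simp_all add: substr_def)

locale reindex =
  fixes A :: "('a, 'f, 'r, 'z) relstruct_scheme" and M :: "('m, 'f, 'r, 'w) relstruct_scheme"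
    and S :: "'i set" and B h k S' q B' h' k'
  assumes sg: "sig A = sig M" and str: "is_struct A"
    and sub: "subuniverse (power_str M S) B"
    and h: "h \<in> hom A (substr (power_str M S) B)"
    and k: "k \<in> hom (substr (power_str M S) B) A"
    and kh: "\<And>a. a \<in> carrier A \<Longrightarrow> k (h a) = a"
    and hk: "\<And>b. b \<in> B \<Longrightarrow> h (k b) = b"
  defines "S' \<equiv> (\<lambda>s. \<lambda>a\<in>carrier A. h a s) ` S"
    and "q \<equiv> \<lambda>y. \<lambda>s\<in>S. y (\<lambda>a\<in>carrier A. h a s)"
    and "B' \<equiv> {y \<in> S' \<rightarrow>\<^sub>E carrier M. q y \<in> B}"
    and "h' \<equiv> \<lambda>a\<in>carrier A. \<lambda>\<sigma>\<in>S'. \<sigma> a"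
    and "k' \<equiv> \<lambda>y\<in>B'. k (q y)"
begin

lemma hB: "a \<in> carrier A \<Longrightarrow> h a \<in> B"
  using h by (auto simp: hom_def substr_def)

lemma BP: "b \<in> B \<Longrightarrow> b \<in> S \<rightarrow>\<^sub>E carrier M"
  using sub by (auto simp: subuniverse_def power_str_def)

lemma kA: "b \<in> B \<Longrightarrow> k b \<in> carrier A"
  using k by (auto simp: hom_def substr_def)

lemma h'P: "a \<in> carrier A \<Longrightarrow> h' a \<in> S' \<rightarrow>\<^sub>E carrier M"
  using BP[OF hB, of a] by (auto simp: h'_def S'_def)

lemma qh': "a \<in> carrier A \<Longrightarrow> q (h' a) = h a"
  using BP[OF hB, of a] by (auto simp: h'_def q_def S'_def fun_eq_iff PiE_def extensional_def)

lemma h'B: "a \<in> carrier A \<Longrightarrow> h' a \<in> B'"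
  using h'P qh' hB by (auto simp: B'_def)

lemma q_at: "s \<in> S \<Longrightarrow> q y s = y (\<lambda>a\<in>carrier A. h a s)"
  by (simp add: q_def)

lemma q_inj: "y \<in> S' \<rightarrow>\<^sub>E carrier M \<Longrightarrow> z \<in> S' \<rightarrow>\<^sub>E carrier M \<Longrightarrow> q y = q z \<Longrightarrow> y = z"
proof (rule PiE_ext)
  fix \<sigma> assume "q y = q z" "\<sigma> \<in> S'"
  then show "y \<sigma> = z \<sigma>" using q_at by (metis (mono_tags, lifting) S'_def imageE)
qed

lemma q_opn: "q (opn (power_str M S') f ys) = opn (power_str M S) f (map q ys)"
proof
  fix s
  show "q (opn (power_str M S') f ys) s = opn (power_str M S) f (map q ys) s"
    by (cases "s \<in> S") (auto simp: q_def power_str_def S'_def comp_def)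
qed

lemma mapq: "ys \<in> tuples B' n \<Longrightarrow> map q ys \<in> tuples B n"
  by (auto simp: tuples_def B'_def)

lemma sub': "subuniverse (power_str M S') B'"
  unfolding subuniverse_def
proof (intro conjI ballI)
  show "B' \<subseteq> carrier (power_str M S')" by (auto simp: B'_def power_str_def)
  fix f ys assume f: "f \<in> opsyms (sig (power_str M S'))"
    and ys: "ys \<in> tuples B' (opar (sig (power_str M S')) f)"
  have *: "q (opn (power_str M S') f ys) \<in> B"
    unfolding q_opn using f mapq[OF ys] sub unfolding subuniverse_def power_str_simps by blast
  have "opn (power_str M S') f ys \<in> S' \<rightarrow>\<^sub>E carrier M"
  proof (rule PiE_I)
    fix \<sigma> assume "\<sigma> \<in> S'"
    then obtain s where s: "s \<in> S" "\<sigma> = (\<lambda>a\<in>carrier A. h a s)" by (auto simp: S'_def)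
    then have "opn (power_str M S') f ys \<sigma> = q (opn (power_str M S') f ys) s"
      by (simp add: q_at)
    then show "opn (power_str M S') f ys \<sigma> \<in> carrier M" using BP[OF *] s by auto
  qed (auto simp: power_str_def)
  with * show "opn (power_str M S') f ys \<in> B'" by (simp add: B'_def)
qed

lemma rel_iff:
  assumes "ys \<in> tuples B' (relar (sig M) r)"
  shows "ys \<in> rel (power_str M S') r \<longleftrightarrow> map q ys \<in> rel (power_str M S) r"
proof -
  have "ys \<in> tuples (S' \<rightarrow>\<^sub>E carrier M) (relar (sig M) r)"
    using assms by (auto simp: tuples_def B'_def)
  moreover have "map q ys \<in> tuples (S \<rightarrow>\<^sub>E carrier M) (relar (sig M) r)"
    using mapq[OF assms] BP by (auto simp: tuples_def)
  ultimately show ?thesis by (auto simp: power_str_def S'_def q_def comp_def)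
qed

lemma h'_hom: "h' \<in> hom A (substr (power_str M S') B')"
  unfolding hom_def mem_Collect_eq
proof (intro conjI ballI)
  show "h' \<in> carrier A \<rightarrow>\<^sub>E carrier (substr (power_str M S') B')"
    using h'B by (auto simp: substr_def h'_def)
next
  fix f xs assume f: "f \<in> opsyms (sig A)" and xs: "xs \<in> tuples (carrier A) (opar (sig A) f)"
  have o: "opn A f xs \<in> carrier A" using str f xs by (auto simp: is_struct_def)
  have m: "map h' xs \<in> tuples B' (opar (sig A) f)" using xs h'B by (auto simp: tuples_def)
  then have b: "opn (power_str M S') f (map h' xs) \<in> B'"
    using sub' f sg unfolding subuniverse_def power_str_simps by simp
  have mq: "map q (map h' xs) = map h xs" using xs qh' by (auto simp: tuples_def)
  have "q (h' (opn A f xs)) = opn (power_str M S) f (map h xs)"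
    using h f xs unfolding qh'[OF o] hom_def substr_simps by blast
  also have "\<dots> = q (opn (power_str M S') f (map h' xs))" by (simp only: q_opn mq)
  finally show "h' (opn A f xs) = opn (substr (power_str M S') B') f (map h' xs)"
    using q_inj b h'P[OF o] by (auto simp: B'_def substr_def)
next
  fix r xs assume r: "r \<in> relsyms (sig A)" and xs: "xs \<in> rel A r"
  have x: "xs \<in> tuples (carrier A) (relar (sig M) r)" using str r xs sg by (auto simp: is_struct_def)
  then have m: "map h' xs \<in> tuples B' (relar (sig M) r)" using h'B by (auto simp: tuples_def)
  have mq: "map q (map h' xs) = map h xs" using x qh' by (auto simp: tuples_def)
  have "map h xs \<in> rel (power_str M S) r" using h r xs by (auto simp: hom_def substr_def)
  then have "map h' xs \<in> rel (power_str M S') r" using rel_iff[OF m] unfolding mq by blast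
  then show "map h' xs \<in> rel (substr (power_str M S') B') r"
    using m by (auto simp: substr_def tuples_def)
qed

lemma k'_hom: "k' \<in> hom (substr (power_str M S') B') A"
  unfolding hom_def mem_Collect_eq
proof (intro conjI ballI)
  show "k' \<in> carrier (substr (power_str M S') B') \<rightarrow>\<^sub>E carrier A"
    using kA by (auto simp: substr_def k'_def B'_def)
next
  fix f ys assume "f \<in> opsyms (sig (substr (power_str M S') B'))"
    and "ys \<in> tuples (carrier (substr (power_str M S') B')) (opar (sig (substr (power_str M S') B')) f)"
  then have f: "f \<in> opsyms (sig M)" and ys: "ys \<in> tuples B' (opar (sig M) f)"
    by (auto simp: substr_def power_str_def)
  have b: "opn (power_str M S') f ys \<in> B'"
    using sub' f ys unfolding subuniverse_def power_str_simps by simp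
  have "map k' ys = map k (map q ys)" using ys by (auto simp: tuples_def k'_def)
  moreover have "k (opn (power_str M S) f (map q ys)) = opn A f (map k (map q ys))"
    using k f mapq[OF ys] unfolding hom_def substr_simps power_str_simps by blast
  moreover have "k' (opn (power_str M S') f ys) = k (opn (power_str M S) f (map q ys))"
    unfolding k'_def restrict_apply'[OF b] q_opn ..
  ultimately show "k' (opn (substr (power_str M S') B') f ys) = opn A f (map k' ys)"
    unfolding substr_simps by (simp only:)
next
  fix r ys assume r: "r \<in> relsyms (sig (substr (power_str M S') B'))"
    and ys: "ys \<in> rel (substr (power_str M S') B') r"
  have t: "ys \<in> tuples B' (relar (sig M) r)" using ys
    by (auto simp: substr_def power_str_def tuples_def)
  have "map q ys \<in> rel (substr (power_str M S) B) r"
    using rel_iff[OF t] ys mapq[OF t] by (auto simp: substr_def tuples_def)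
  then have "map k (map q ys) \<in> rel A r" using k r unfolding hom_def mem_Collect_eq substr_simps(1) power_str_simps(1) by blast
  moreover have "map k' ys = map k (map q ys)" using t by (auto simp: tuples_def k'_def)
  ultimately show "map k' ys \<in> rel A r" by (simp only:)
qed

lemma k'h': "a \<in> carrier A \<Longrightarrow> k' (h' a) = a"
  using h'B by (simp add: k'_def qh' kh)

lemma h'k': "y \<in> B' \<Longrightarrow> h' (k' y) = y"
  by (rule q_inj) (auto simp: k'_def B'_def qh' kA hk h'P)

end

lemma ISP_any_exponent:
  fixes S :: "'i set" and M :: "('m, 'f, 'r) relstruct" and A :: "('a, 'f, 'r) relstruct"
  assumes "sig A = sig M" "is_struct A" "B \<noteq> {}" "subuniverse (power_str M S) B"
    and "isomorphism A (substr (power_str M S) B) h"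
  shows "A \<in> ISP M"
proof -
  from assms(5) obtain k where hk: "h \<in> hom A (substr (power_str M S) B)"
    "k \<in> hom (substr (power_str M S) B) A"
    "\<And>a. a \<in> carrier A \<Longrightarrow> k (h a) = a" "\<And>b. b \<in> B \<Longrightarrow> h (k b) = b"
    by (auto simp: isomorphism_def substr_def)
  define S' where "S' = (\<lambda>s. \<lambda>a\<in>carrier A. h a s) ` S"
  define q where "q = (\<lambda>y :: ('a \<Rightarrow> 'm) \<Rightarrow> 'm. \<lambda>s\<in>S. y (\<lambda>a\<in>carrier A. h a s))"
  define B' where "B' = {y \<in> S' \<rightarrow>\<^sub>E carrier M. q y \<in> B}"
  define h' where "h' = (\<lambda>a\<in>carrier A. \<lambda>\<sigma>\<in>S'. \<sigma> a)"
  define k' where "k' = (\<lambda>y\<in>B'. k (q y))"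
  interpret reindex A M S B h k S' q B' h' k'
    using assms hk by unfold_locales (auto simp: S'_def q_def B'_def h'_def k'_def)
  have "B' \<noteq> {}" using assms(3) kA h'B by blast
  moreover have "isomorphism A (substr (power_str M S') B') h'"
    unfolding isomorphism_def substr_simps using h'_hom k'_hom k'h' h'k' by blast
  ultimately show ?thesis using assms(1,2) sub' unfolding ISP_def by blast
qed

lemma tsubstr_power_top_simps:
  "carrier (tsubstr (power_top M S) B) = B"
  "topol (tsubstr (power_top M S) B) = subtopology (product_topology (\<lambda>_. topol M) S) B"
  "hom X (tsubstr (power_top M S) B) = hom X (substr (power_str M S) B)"
  "hom (tsubstr (power_top M S) B) X = hom (substr (power_str M S) B) X"
  "subuniverse (power_top M S) B = subuniverse (power_str M S) B"
  by (simp_all add: tsubstr_def power_top_def substr_def hom_def subuniverse_def power_str_def)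

lemma IScP_any_exponent:
  fixes S :: "'i set" and M :: "('m, 'f, 'r) topstruct" and X :: "('x, 'f, 'r) topstruct"
  assumes "sig X = sig M" "is_struct X" "topspace (topol X) = carrier X"
    and "topspace (topol M) = carrier M"
    and "S \<noteq> {}" "closedin (topol (power_top M S)) B" "subuniverse (power_top M S) B"
    and "top_isomorphism X (tsubstr (power_top M S) B) h"
  shows "X \<in> IScP M"
proof -
  from assms(8) obtain k where hk: "h \<in> hom X (substr (power_str M S) B)"
    "k \<in> hom (substr (power_str M S) B) X"
    "\<And>a. a \<in> carrier X \<Longrightarrow> k (h a) = a" "\<And>b. b \<in> B \<Longrightarrow> h (k b) = b"
    and hc: "continuous_map (topol X) (subtopology (product_topology (\<lambda>_. topol M) S) B) h"
    and kc: "continuous_map (subtopology (product_topology (\<lambda>_. topol M) S) B) (topol X) k"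
    by (auto simp: top_isomorphism_def chom_def tsubstr_power_top_simps)
  define S' where "S' = (\<lambda>s. \<lambda>a\<in>carrier X. h a s) ` S"
  define q where "q = (\<lambda>y :: ('x \<Rightarrow> 'm) \<Rightarrow> 'm. \<lambda>s\<in>S. y (\<lambda>a\<in>carrier X. h a s))"
  define B' where "B' = {y \<in> S' \<rightarrow>\<^sub>E carrier M. q y \<in> B}"
  define h' where "h' = (\<lambda>a\<in>carrier X. \<lambda>\<sigma>\<in>S'. \<sigma> a)"
  define k' where "k' = (\<lambda>y\<in>B'. k (q y))"
  interpret reindex X M S B h k S' q B' h' k'
    using assms hk by unfold_locales
      (auto simp: tsubstr_power_top_simps S'_def q_def B'_def h'_def k'_def)
  let ?P = "product_topology (\<lambda>_. topol M) S" and ?P' = "product_topology (\<lambda>_. topol M) S'"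
  have qc: "continuous_map ?P' ?P q"
    unfolding continuous_map_componentwise
  proof (intro conjI ballI)
    show "q ` topspace ?P' \<subseteq> extensional S" by (auto simp: q_def)
    fix s assume "s \<in> S"
    then show "continuous_map ?P' (topol M) (\<lambda>y. q y s)"
      by (auto simp: q_at S'_def intro!: continuous_map_product_projection)
  qed
  have "B' = {y \<in> topspace ?P'. q y \<in> B}" by (simp add: B'_def assms(4))
  then have cl: "closedin ?P' B'"
    using closedin_continuous_map_preimage[OF qc] assms(6) by (simp add: power_top_def)
  have "continuous_map (topol X) ?P' h'"
    unfolding continuous_map_componentwise
  proof (intro conjI ballI)
    show "h' ` topspace (topol X) \<subseteq> extensional S'" by (auto simp: h'_def assms(3))
    fix \<sigma> assume \<sigma>: "\<sigma> \<in> S'"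
    then obtain s where s: "s \<in> S" "\<sigma> = (\<lambda>a\<in>carrier X. h a s)" by (auto simp: S'_def)
    have "continuous_map (topol X) (topol M) (\<lambda>a. h a s)"
      using hc s(1) by (auto simp: continuous_map_in_subtopology continuous_map_componentwise)
    then show "continuous_map (topol X) (topol M) (\<lambda>a. h' a \<sigma>)"
      by (rule continuous_map_eq) (use \<sigma> s in \<open>auto simp: h'_def assms(3)\<close>)
  qed
  then have h'c: "h' \<in> chom X (tsubstr (power_top M S') B')"
    using h'_hom h'B
    by (auto simp: chom_def tsubstr_power_top_simps continuous_map_in_subtopology assms(3))
  have "continuous_map (subtopology ?P' B') (topol X) (k \<circ> q)"
  proof (rule continuous_map_compose[OF _ kc])
    show "continuous_map (subtopology ?P' B') (subtopology ?P B) q"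
      by (auto simp: continuous_map_in_subtopology B'_def
            intro: continuous_map_from_subtopology[OF qc])
  qed
  then have "continuous_map (subtopology ?P' B') (topol X) k'"
    by (rule continuous_map_eq) (auto simp: k'_def)
  then have "k' \<in> chom (tsubstr (power_top M S') B') X"
    using k'_hom by (auto simp: chom_def tsubstr_power_top_simps)
  then have "top_isomorphism X (tsubstr (power_top M S') B') h'"
    using h'c k'h' h'k' by (auto simp: top_isomorphism_def tsubstr_power_top_simps)
  moreover have "S' \<noteq> {}" using assms(5) by (simp add: S'_def)
  moreover have "subuniverse (power_top M S') B'"
    using sub' by (simp add: tsubstr_power_top_simps)
  moreover have "closedin (topol (power_top M S')) B'" using cl by (simp add: power_top_def)
  ultimately show ?thesis using assms(1-3) unfolding IScP_def by blast
qed

text \<open>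
  HOL cannot quantify over all types inside a formula. Notions that quantify over all objects of
  these classes therefore take the type of the elements of the objects as a parameter. A notion
  holds in the usual sense if it holds for every such type.
\<close>

definition injective_ISP :: "'a itself \<Rightarrow> ('m, 'f, 'r) relstruct \<Rightarrow> bool" where
  "injective_ISP _ M \<longleftrightarrow>
     (\<forall>(A :: ('a, 'f, 'r) relstruct) \<in> ISP M. \<forall>(B :: ('a, 'f, 'r) relstruct) \<in> ISP M.
        \<forall>j. embedding A B j \<longrightarrow>
          (\<forall>\<phi>\<in>hom A M. \<exists>\<psi>\<in>hom B M. \<forall>a\<in>carrier A. \<psi> (j a) = \<phi> a))"

definition injective_IScP :: "'x itself \<Rightarrow> ('m, 'f, 'r) topstruct \<Rightarrow> bool" where
  "injective_IScP _ M \<longleftrightarrow>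
     (\<forall>(X :: ('x, 'f, 'r) topstruct) \<in> IScP M. \<forall>(Y :: ('x, 'f, 'r) topstruct) \<in> IScP M.
        \<forall>j. top_embedding X Y j \<longrightarrow>
          (\<forall>\<phi>\<in>chom X M. \<exists>\<psi>\<in>chom Y M. \<forall>x\<in>carrier X. \<psi> (j x) = \<phi> x))"


section \<open>Alter egos and dualities\<close>

definition operations_continuous ::
  "('a, 'f, 'r, 'z) relstruct_scheme \<Rightarrow> 'a topology \<Rightarrow> bool" where
  "operations_continuous A T \<longleftrightarrow>
     (\<forall>f\<in>opsyms (sig A). continuous_map (tuple_topology T (opar (sig A) f)) T (opn A f))"

definition alter_ego ::
  "('m, 'f1, 'r1) relstruct \<Rightarrow> ('m, 'f2, 'r2) topstruct \<Rightarrow> bool" where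
  "alter_ego M Mt \<longleftrightarrow> carrier Mt = carrier M \<and>
     (\<forall>r\<in>relsyms (sig Mt). rel Mt r \<noteq> {} \<and>
        subuniverse (npower M (relar (sig Mt) r)) (rel Mt r)) \<and>
     (\<forall>g\<in>opsyms (sig Mt). restrict (opn Mt g) (tuples (carrier M) (opar (sig Mt) g))
        \<in> hom (npower M (opar (sig Mt) g)) M) \<and>
     (\<forall>r\<in>relsyms (sig M). closedin (tuple_topology (topol Mt) (relar (sig M) r)) (rel M r)) \<and>
     operations_continuous M (topol Mt)"

definition Dual ::
  "('m, 'f1, 'r1) relstruct \<Rightarrow> ('m, 'f2, 'r2) topstruct \<Rightarrow> ('a, 'f1, 'r1) relstruct \<Rightarrow>
     ('a \<Rightarrow> 'm, 'f2, 'r2) topstruct" where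
  "Dual M Mt A = tsubstr (power_top Mt (carrier A)) (hom A M)"

definition Edual ::
  "('m, 'f1, 'r1) relstruct \<Rightarrow> ('m, 'f2, 'r2) topstruct \<Rightarrow> ('x, 'f2, 'r2) topstruct \<Rightarrow>
     ('x \<Rightarrow> 'm, 'f1, 'r1) relstruct" where
  "Edual M Mt X = substr (power_str M (carrier X)) (chom X Mt)"

definition dualises ::
  "'a itself \<Rightarrow> ('m, 'f2, 'r2) topstruct \<Rightarrow> ('m, 'f1, 'r1) relstruct \<Rightarrow> bool" where
  "dualises _ Mt M \<longleftrightarrow>
     (\<forall>(A :: ('a, 'f1, 'r1) relstruct) \<in> ISP M.
        isomorphism A (Edual M Mt (Dual M Mt A)) (\<lambda>a\<in>carrier A. \<lambda>x\<in>hom A M. x a))"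

definition co_dualises ::
  "'x itself \<Rightarrow> ('m, 'f2, 'r2) topstruct \<Rightarrow> ('m, 'f1, 'r1) relstruct \<Rightarrow> bool" where
  "co_dualises _ Mt M \<longleftrightarrow>
     (\<forall>(X :: ('x, 'f2, 'r2) topstruct) \<in> IScP Mt.
        top_isomorphism X (Dual M Mt (Edual M Mt X)) (\<lambda>x\<in>carrier X. \<lambda>\<alpha>\<in>chom X Mt. \<alpha> x))"

definition fully_dualises ::
  "'a itself \<Rightarrow> 'x itself \<Rightarrow> ('m, 'f2, 'r2) topstruct \<Rightarrow> ('m, 'f1, 'r1) relstruct \<Rightarrow> bool" where
  "fully_dualises ta tx Mt M \<longleftrightarrow> dualises ta Mt M \<and> co_dualises tx Mt M"


section \<open>Term functions, separation and structural reducts\<close>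

datatype 'f trm = Var nat | App 'f "'f trm list"

primrec wf_trm :: "('f, 'r) signature \<Rightarrow> nat \<Rightarrow> 'f trm \<Rightarrow> bool" where
  "wf_trm \<Sigma> n (Var i) \<longleftrightarrow> i < n"
| "wf_trm \<Sigma> n (App f ts) \<longleftrightarrow>
     f \<in> opsyms \<Sigma> \<and> length ts = opar \<Sigma> f \<and> list_all (wf_trm \<Sigma> n) ts"

primrec eval_trm :: "('a, 'f, 'r, 'z) relstruct_scheme \<Rightarrow> 'a list \<Rightarrow> 'f trm \<Rightarrow> 'a" where
  "eval_trm A xs (Var i) = xs ! i"
| "eval_trm A xs (App f ts) = opn A f (map (eval_trm A xs) ts)"

definition term_functions ::
  "('a, 'f, 'r, 'z) relstruct_scheme \<Rightarrow> nat \<Rightarrow> ('a list \<Rightarrow> 'a) set" where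
  "term_functions A n =
     {(\<lambda>xs\<in>tuples (carrier A) n. eval_trm A xs t) | t. wf_trm (sig A) n t}"

definition Clo1 :: "('a, 'f, 'r, 'z) relstruct_scheme \<Rightarrow> ('a \<Rightarrow> 'a) set" where
  "Clo1 A = {(\<lambda>a\<in>carrier A. g [a]) | g. g \<in> term_functions A 1}"

definition named_constants :: "('a, 'f, 'r, 'z) relstruct_scheme \<Rightarrow> bool" where
  "named_constants A \<longleftrightarrow>
     (\<forall>u\<in>Clo1 A. \<forall>c. (\<forall>a\<in>carrier A. u a = c) \<longrightarrow> (\<exists>g\<in>term_functions A 0. g [] = c))"

definition comp_maps :: "('b \<Rightarrow> 'c) set \<Rightarrow> ('a \<Rightarrow> 'b) set \<Rightarrow> ('a \<Rightarrow> 'c) set" where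
  "comp_maps \<Omega> U = {\<omega> \<circ> u | \<omega> u. \<omega> \<in> \<Omega> \<and> u \<in> U}"

definition separates_points :: "('a \<Rightarrow> 'b) set \<Rightarrow> 'a set \<Rightarrow> bool" where
  "separates_points Z A \<longleftrightarrow> (\<forall>a\<in>A. \<forall>b\<in>A. a \<noteq> b \<longrightarrow> (\<exists>z\<in>Z. z a \<noteq> z b))"

definition separates_structure ::
  "('a \<Rightarrow> 'b) set \<Rightarrow> ('a, 'f, 'r, 'z) relstruct_scheme \<Rightarrow> ('b, 'f, 'r, 'w) relstruct_scheme \<Rightarrow> bool"
  where
  "separates_structure Z A N \<longleftrightarrow> separates_points Z (carrier A) \<and>
     (\<forall>r\<in>relsyms (sig A). \<forall>as\<in>tuples (carrier A) (relar (sig A) r).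
        as \<notin> rel A r \<longrightarrow> (\<exists>z\<in>Z. map z as \<notin> rel N r))"

datatype ('f, 'r) atomic = Equal "'f trm" "'f trm" | Holds 'r "'f trm list"

primrec wf_atomic :: "('f, 'r) signature \<Rightarrow> nat \<Rightarrow> ('f, 'r) atomic \<Rightarrow> bool" where
  "wf_atomic \<Sigma> n (Equal s t) \<longleftrightarrow> wf_trm \<Sigma> n s \<and> wf_trm \<Sigma> n t"
| "wf_atomic \<Sigma> n (Holds r ts) \<longleftrightarrow>
     r \<in> relsyms \<Sigma> \<and> length ts = relar \<Sigma> r \<and> list_all (wf_trm \<Sigma> n) ts"

primrec sat_atomic ::
  "('a, 'f, 'r, 'z) relstruct_scheme \<Rightarrow> 'a list \<Rightarrow> ('f, 'r) atomic \<Rightarrow> bool" where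
  "sat_atomic A xs (Equal s t) \<longleftrightarrow> eval_trm A xs s = eval_trm A xs t"
| "sat_atomic A xs (Holds r ts) \<longleftrightarrow> map (eval_trm A xs) ts \<in> rel A r"

definition conjunct_atomic_definable ::
  "('a, 'f, 'r, 'z) relstruct_scheme \<Rightarrow> nat \<Rightarrow> 'a list set \<Rightarrow> bool" where
  "conjunct_atomic_definable A n s \<longleftrightarrow>
     (\<exists>\<Phi>. finite \<Phi> \<and> (\<forall>\<phi>\<in>\<Phi>. wf_atomic (sig A) n \<phi>) \<and>
        s = {xs \<in> tuples (carrier A) n. \<forall>\<phi>\<in>\<Phi>. sat_atomic A xs \<phi>})"

definition structural_reduct ::
  "('a, 'f, 'r, 'z) relstruct_scheme \<Rightarrow> ('a, 'g, 'q, 'w) relstruct_scheme \<Rightarrow> bool" where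
  "structural_reduct A A' \<longleftrightarrow> carrier A' = carrier A \<and>
     (\<forall>g\<in>opsyms (sig A'). restrict (opn A' g) (tuples (carrier A) (opar (sig A') g))
        \<in> term_functions A (opar (sig A') g)) \<and>
     (\<forall>r\<in>relsyms (sig A'). conjunct_atomic_definable A (relar (sig A') r) (rel A' r))"


section \<open>Maximal relations and entailment\<close>

definition rel_preimage ::
  "'m set \<Rightarrow> ('m \<Rightarrow> 'n) list \<Rightarrow> 'n list set \<Rightarrow> 'm list set" where
  "rel_preimage M \<omega>s r = {as \<in> tuples M (length \<omega>s). map2 (\<lambda>\<omega> a. \<omega> a) \<omega>s as \<in> r}"

definition diagonal :: "'n set \<Rightarrow> 'n list set" where
  "diagonal N = {[a, a] | a. a \<in> N}"

definition ker_rel :: "'m set \<Rightarrow> 'n set \<Rightarrow> ('m \<Rightarrow> 'n) \<Rightarrow> 'm list set" where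
  "ker_rel M N \<omega> = rel_preimage M [\<omega>, \<omega>] (diagonal N)"

text \<open>
  As in \<open>IS\<^sub>cP\<^sup>+\<close>, the empty set is admitted as a substructure if there are no nullary
  operations. It is maximal in \<open>P\<close> only if \<open>P\<close> contains no non-empty substructure at all, and
  it has to be admitted for that case: entailment is tested on the empty structure too, and
  a structure \<open>M\<close> entails the empty relation if and only if there is no morphism to \<open>M\<close> from
  the one-element structure \<open>Edual M Mt X\<close> with \<open>X\<close> empty.
\<close>

definition maximal_sub ::
  "('m, 'f, 'r, 'z) relstruct_scheme \<Rightarrow> nat \<Rightarrow> 'm list set \<Rightarrow> 'm list set \<Rightarrow> bool" where
  "maximal_sub A n P s \<longleftrightarrow> subuniverse (npower A n) s \<and> s \<subseteq> P \<and>
     (\<forall>s'. subuniverse (npower A n) s' \<and> s' \<subseteq> P \<and> s \<subseteq> s' \<longrightarrow> s' = s)"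

definition max_rels ::
  "('m, 'f, 'r, 'z) relstruct_scheme \<Rightarrow> ('m \<Rightarrow> 'n) set \<Rightarrow> nat \<Rightarrow> 'n list set \<Rightarrow>
     'm list set set" where
  "max_rels A \<Omega> n r =
     {s. \<exists>\<omega>s. length \<omega>s = n \<and> set \<omega>s \<subseteq> \<Omega> \<and>
           maximal_sub A n (rel_preimage (carrier A) \<omega>s r) s}"

definition entails ::
  "'x itself \<Rightarrow> ('m, 'f1, 'r1) relstruct \<Rightarrow> ('m, 'f2, 'r2) topstruct \<Rightarrow> nat \<Rightarrow> 'm list set \<Rightarrow> bool"
  where
  "entails _ M Mt n r \<longleftrightarrow>
     closedin (tuple_topology (topol Mt) n) r \<and> subuniverse (npower Mt n) r \<and>
     (\<forall>(X :: ('x, 'f2, 'r2) topstruct) \<in> IScP Mt. \<forall>u\<in>hom (Edual M Mt X) M.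
        \<forall>\<alpha>s\<in>tuples (chom X Mt) n.
          (\<forall>x\<in>carrier X. map (\<lambda>\<alpha>. \<alpha> x) \<alpha>s \<in> r) \<longrightarrow> map u \<alpha>s \<in> r)"

end

theory Submission
  imports Defs
begin

text \<open>
  Every \<open>X\<close> in \<open>IS\<^sub>cP\<^sup>+(Mt)\<close> is separated by its morphisms into \<open>Mt\<close>, so by compactness the evaluation
  map of \<open>X\<close> is an embedding and only its surjectivity is at stake. Let \<open>u\<close> be a homomorphism from
  the dual \<open>E(X)\<close> of \<open>X\<close> to \<open>M\<close>. Inside the dual of the reduct \<open>X\<^sup>b\<close> of \<open>X\<close> with respect to \<open>N\<close>, consider
  the set \<open>W\<close> of all maps \<open>\<omega> \<circ> \<alpha>\<close> with \<open>\<omega>\<close> in \<open>\<Omega>\<close> and \<open>\<alpha>\<close> in \<open>E(X)\<close>. The assignment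
  \<open>\<omega> \<circ> \<alpha> \<mapsto> \<omega>(u(\<alpha>))\<close> is a well-defined homomorphism from \<open>W\<close> to \<open>N\<close>: the joint image of
  \<open>\<alpha>\<^sub>1, \<dots>, \<alpha>\<^sub>n\<close> is a substructure, by Zorn's lemma it lies in a maximal one inside the preimage of
  the relation in question, and \<open>u\<close> preserves the latter by entailment (if instead \<open>\<omega> \<circ> Clo\<^sub>1(Mt)\<close>
  separates points, then \<open>\<omega> \<circ> \<alpha>\<close> already determines \<open>\<alpha>\<close>). Injectivity of \<open>N\<close> extends
  this homomorphism to the dual of \<open>X\<^sup>b\<close>, where by co-duality of \<open>N\<close> it is evaluation at a point \<open>x\<close>.
  Since \<open>\<Omega> \<circ> Clo\<^sub>1(M)\<close> separates points, \<open>u\<close> itself is evaluation at \<open>x\<close>.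
\<close>

section \<open>Tuples and the defining properties of homomorphisms and structures\<close>

lemma tuples_nth: "xs \<in> tuples A n \<Longrightarrow> i < n \<Longrightarrow> xs ! i \<in> A"
  by (auto simp: tuples_def)

lemma map_in_tuples: "xs \<in> tuples A n \<Longrightarrow> (\<And>x. x \<in> A \<Longrightarrow> f x \<in> B) \<Longrightarrow> map f xs \<in> tuples B n"
  by (auto simp: tuples_def)

text \<open>Choosing preimages entry by entry lifts a tuple over an image to the source. Closure of
  an image under operations is checked below by lifting arguments in this way.\<close>

lemma tuples_image: "tuples (f ` A) n = map f ` tuples A n"
proof
  show "tuples (f ` A) n \<subseteq> map f ` tuples A n"
  proof
    fix ys assume ys: "ys \<in> tuples (f ` A) n"
    then have "ys = map f (map (inv_into A f) ys)"
      by (auto simp: tuples_def f_inv_into_f intro!: map_idI[symmetric])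
    moreover have "map (inv_into A f) ys \<in> tuples A n"
      using ys by (rule map_in_tuples) (rule inv_into_into)
    ultimately show "ys \<in> map f ` tuples A n" by (rule image_eqI)
  qed
qed (auto intro: map_in_tuples)

lemma homD_carrier: "h \<in> hom A B \<Longrightarrow> a \<in> carrier A \<Longrightarrow> h a \<in> carrier B"
  by (auto simp: hom_def)

lemma homD_opn:
  "h \<in> hom A B \<Longrightarrow> f \<in> opsyms (sig A) \<Longrightarrow> xs \<in> tuples (carrier A) (opar (sig A) f) \<Longrightarrow>
     h (opn A f xs) = opn B f (map h xs)"
  by (auto simp: hom_def)

lemma homD_rel:
  "h \<in> hom A B \<Longrightarrow> r \<in> relsyms (sig A) \<Longrightarrow> xs \<in> rel A r \<Longrightarrow> map h xs \<in> rel B r"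
  by (auto simp: hom_def)

lemma is_structD_opn:
  "is_struct A \<Longrightarrow> f \<in> opsyms (sig A) \<Longrightarrow> xs \<in> tuples (carrier A) (opar (sig A) f) \<Longrightarrow>
     opn A f xs \<in> carrier A"
  by (auto simp: is_struct_def)

lemma is_structD_rel:
  "is_struct A \<Longrightarrow> r \<in> relsyms (sig A) \<Longrightarrow> xs \<in> rel A r \<Longrightarrow>
     xs \<in> tuples (carrier A) (relar (sig A) r)"
  by (auto simp: is_struct_def)


section \<open>Terms and atomic formulas under homomorphisms\<close>

lemma eval_trm_in_carrier:
  assumes "is_struct A" and "xs \<in> tuples (carrier A) n" and "wf_trm (sig A) n t"
  shows "eval_trm A xs t \<in> carrier A"
  using assms(3)
proof (induction t)
  case (Var i)
  then show ?case using assms(2) by (simp add: tuples_nth)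
next
  case (App f ts)
  then have "map (eval_trm A xs) ts \<in> tuples (carrier A) (opar (sig A) f)"
    by (auto simp: tuples_def list_all_iff)
  with App.prems assms(1) show ?case by (simp add: is_structD_opn)
qed

lemma hom_eval_trm:
  assumes "h \<in> hom A B" and "is_struct A" and "xs \<in> tuples (carrier A) n"
    and "wf_trm (sig A) n t"
  shows "h (eval_trm A xs t) = eval_trm B (map h xs) t"
  using assms(4)
proof (induction t)
  case (Var i)
  then show ?case using assms(3) by (simp add: tuples_def)
next
  case (App f ts)
  then have w: "\<forall>t\<in>set ts. wf_trm (sig A) n t" by (simp add: list_all_iff)
  then have "map (eval_trm A xs) ts \<in> tuples (carrier A) (opar (sig A) f)"
    using App.prems eval_trm_in_carrier[OF assms(2,3)] by (auto simp: tuples_def)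
  then have "h (eval_trm A xs (App f ts)) = opn B f (map h (map (eval_trm A xs) ts))"
    using App.prems homD_opn[OF assms(1)] by simp
  also have "map h (map (eval_trm A xs) ts) = map (eval_trm B (map h xs)) ts"
    using App.IH w by auto
  finally show ?case by simp
qed

lemma hom_sat_atomic:
  assumes "h \<in> hom A B" and "is_struct A" and "xs \<in> tuples (carrier A) n"
    and "wf_atomic (sig A) n \<phi>" and "sat_atomic A xs \<phi>"
  shows "sat_atomic B (map h xs) \<phi>"
proof (cases \<phi>)
  case (Equal s t)
  then show ?thesis
    using assms(4,5) hom_eval_trm[OF assms(1-3), of s] hom_eval_trm[OF assms(1-3), of t] by simp
next
  case (Holds r ts)
  then have w: "\<forall>t\<in>set ts. wf_trm (sig A) n t" and r: "r \<in> relsyms (sig A)"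
    using assms(4) by (simp_all add: list_all_iff)
  have "map h (map (eval_trm A xs) ts) \<in> rel B r"
    using homD_rel[OF assms(1) r] assms(5) Holds by (simp del: map_map)
  moreover have "map h (map (eval_trm A xs) ts) = map (eval_trm B (map h xs)) ts"
    using w hom_eval_trm[OF assms(1-3)] by auto
  ultimately show ?thesis using Holds by (simp only: sat_atomic.simps)
qed

text \<open>Homomorphisms preserve atomic formulas; a separating family jointly reflects them as
  well. Separation of points handles equations, separation of relations handles the rest, since both
  sides of the claim are about the values of terms and homomorphisms commute with terms.\<close>

lemma separating_homs_sat_atomic:
  assumes "is_struct A" and Z: "Z \<subseteq> hom A B" and sep: "separates_structure Z A B"
    and xs: "xs \<in> tuples (carrier A) n" and wf: "wf_atomic (sig A) n \<phi>"
    and sat: "\<And>z. z \<in> Z \<Longrightarrow> sat_atomic B (map z xs) \<phi>"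
  shows "sat_atomic A xs \<phi>"
proof (cases \<phi>)
  case (Equal s t)
  then have "z (eval_trm A xs s) = z (eval_trm A xs t)" if "z \<in> Z" for z
    using wf sat[OF that] hom_eval_trm[OF _ assms(1) xs, of z B] Z that by auto
  moreover have "eval_trm A xs s \<in> carrier A" "eval_trm A xs t \<in> carrier A"
    using Equal wf eval_trm_in_carrier[OF assms(1) xs] by simp_all
  ultimately have "eval_trm A xs s = eval_trm A xs t"
    using sep unfolding separates_structure_def separates_points_def by blast
  then show ?thesis by (simp add: Equal)
next
  case (Holds r ts)
  then have w: "\<forall>t\<in>set ts. wf_trm (sig A) n t" and r: "r \<in> relsyms (sig A)"
    and l: "length ts = relar (sig A) r"
    using wf by (simp_all add: list_all_iff)
  have "map z (map (eval_trm A xs) ts) \<in> rel B r" if "z \<in> Z" for z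
  proof -
    have "map z (map (eval_trm A xs) ts) = map (eval_trm B (map z xs)) ts"
      using w hom_eval_trm[OF _ assms(1) xs, of z B] Z that by auto
    with sat[OF that] Holds show ?thesis by (simp only: sat_atomic.simps)
  qed
  moreover have "map (eval_trm A xs) ts \<in> tuples (carrier A) (relar (sig A) r)"
    using w l eval_trm_in_carrier[OF assms(1) xs] by (auto simp: tuples_def)
  ultimately have "map (eval_trm A xs) ts \<in> rel A r"
    using sep r unfolding separates_structure_def by blast
  then show ?thesis by (simp add: Holds)
qed


section \<open>Compactness and separation\<close>

text \<open>A continuous bijection from a compact space to a Hausdorff space is a homeomorphism. The
  inverse respects operations because the map is bijective, and respects relations because the map
  reflects them.\<close>

lemma top_isomorphismI:
  assumes "sig X = sig Y" and "is_struct X" and "is_struct Y"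
    and "topspace (topol X) = carrier X" and "topspace (topol Y) = carrier Y"
    and "compact_space (topol X)" and "Hausdorff_space (topol Y)"
    and h: "h \<in> chom X Y" and bij: "bij_betw h (carrier X) (carrier Y)"
    and refl: "\<And>r xs. r \<in> relsyms (sig X) \<Longrightarrow> xs \<in> tuples (carrier X) (relar (sig X) r) \<Longrightarrow>
                 map h xs \<in> rel Y r \<Longrightarrow> xs \<in> rel X r"
  shows "top_isomorphism X Y h"
proof -
  have hh: "h \<in> hom X Y" and hc: "continuous_map (topol X) (topol Y) h"
    using h by (simp_all add: chom_def)
  have "homeomorphic_map (topol X) (topol Y) h"
    using assms(4-7) hc bij by (intro continuous_imp_homeomorphic_map) (auto simp: bij_betw_def)
  then obtain k0 where k0: "homeomorphic_maps (topol X) (topol Y) h k0"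
    by (auto simp: homeomorphic_map_maps)
  \<comment> \<open>Members of \<open>hom\<close> are extensional, so the topological inverse has to
    be cut down to the carrier.\<close>
  define k where "k = restrict k0 (carrier Y)"
  have kh: "k (h a) = a" if "a \<in> carrier X" for a
    using k0 that assms(4) homD_carrier[OF hh that] by (simp add: k_def homeomorphic_maps_def)
  have hk: "h (k b) = b" if "b \<in> carrier Y" for b
    using k0 that assms(5) by (simp add: k_def homeomorphic_maps_def)
  have kX: "k b \<in> carrier X" if "b \<in> carrier Y" for b
    proof -
    from that bij obtain a where "a \<in> carrier X" "b = h a" by (auto simp: bij_betw_def)
    then show ?thesis using kh by simp
  qed
  have mhk: "map h (map k ys) = ys" if "ys \<in> tuples (carrier Y) n" for ys n
    using that hk by (auto simp: tuples_def subset_iff intro!: map_idI)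
  have "continuous_map (topol Y) (topol X) k"
    by (rule continuous_map_eq[of _ _ k0])
      (use k0 assms(5) in \<open>auto simp: k_def homeomorphic_maps_def\<close>)
  moreover have "k \<in> hom Y X"
    unfolding hom_def mem_Collect_eq
  proof (intro conjI ballI)
    show "k \<in> carrier Y \<rightarrow>\<^sub>E carrier X" using kX by (auto simp: k_def)
  next
    fix f ys assume f: "f \<in> opsyms (sig Y)" and ys: "ys \<in> tuples (carrier Y) (opar (sig Y) f)"
    have m: "map k ys \<in> tuples (carrier X) (opar (sig X) f)"
      using map_in_tuples[OF ys kX] assms(1) by simp
    have fX: "f \<in> opsyms (sig X)" using f assms(1) by simp
    have "h (opn X f (map k ys)) = opn Y f ys"
      using homD_opn[OF hh fX m] by (simp only: mhk[OF ys])
    then show "k (opn Y f ys) = opn X f (map k ys)"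
      using kh[OF is_structD_opn[OF assms(2) fX m]] by simp
  next
    fix r ys assume r: "r \<in> relsyms (sig Y)" and ys: "ys \<in> rel Y r"
    have t: "ys \<in> tuples (carrier Y) (relar (sig Y) r)" using is_structD_rel[OF assms(3) r ys] .
    have m: "map k ys \<in> tuples (carrier X) (relar (sig X) r)"
      using map_in_tuples[OF t kX] assms(1) by simp
    have "map h (map k ys) \<in> rel Y r" using ys by (simp only: mhk[OF t])
    with m show "map k ys \<in> rel X r" using refl r assms(1) by simp
  qed
  ultimately have "k \<in> chom Y X" by (simp add: chom_def)
  with h kh hk show ?thesis unfolding top_isomorphism_def by blast
qed

text \<open>The coordinate projections of the power, pulled back along the isomorphism
  \<open>h\<close>, are morphisms into \<open>M\<close>. They separate points and, as relations of a
  power are coordinatewise, the structure. Compactness passes from \<open>M\<close> to the power, to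
  its closed subset \<open>B\<close> and through \<open>k\<close> to \<open>X\<close>. The non-empty
  exponent provides a morphism even when \<open>X\<close> is empty.\<close>

lemma IScPD:
  fixes X :: "('x, 'f, 'r) topstruct" and M :: "('m, 'f, 'r) topstruct"
  assumes "X \<in> IScP M" and tM: "total_topstruct M"
  shows "sig X = sig M" "is_struct X" "topspace (topol X) = carrier X" "compact_space (topol X)"
    "chom X M \<noteq> {}" "separates_structure (chom X M) X M"
proof -
  obtain S :: "('x \<Rightarrow> 'm) set" and B h
    where X: "sig X = sig M" "is_struct X" "topspace (topol X) = carrier X"
      and S: "S \<noteq> {}" and cl: "closedin (topol (power_top M S)) B"
      and sub: "subuniverse (power_top M S) B"
      and iso: "top_isomorphism X (tsubstr (power_top M S) B) h"
    using assms(1) by (auto simp: IScP_def)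
  from iso obtain k where h: "h \<in> hom X (substr (power_str M S) B)"
    and k: "k \<in> hom (substr (power_str M S) B) X"
    and kh: "\<And>a. a \<in> carrier X \<Longrightarrow> k (h a) = a"
    and hk: "\<And>b. b \<in> B \<Longrightarrow> h (k b) = b"
    and hc: "continuous_map (topol X) (subtopology (product_topology (\<lambda>_. topol M) S) B) h"
    and kc: "continuous_map (subtopology (product_topology (\<lambda>_. topol M) S) B) (topol X) k"
    by (auto simp: top_isomorphism_def chom_def tsubstr_power_top_simps)
  show "sig X = sig M" "is_struct X" "topspace (topol X) = carrier X" by fact+
  have M: "is_struct M" "topspace (topol M) = carrier M" "compact_space (topol M)"
    using tM by (simp_all add: total_topstruct_def total_structure_def)
  have hB: "h a \<in> B" if "a \<in> carrier X" for a using homD_carrier[OF h that] by (simp add: substr_simps)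
  have BP: "B \<subseteq> S \<rightarrow>\<^sub>E carrier M"
    using sub unfolding tsubstr_power_top_simps
    by (simp add: subuniverse_def power_str_simps)
  have kX: "k b \<in> carrier X" if "b \<in> B" for b using homD_carrier[OF k] that by (simp add: substr_simps)
  let ?P = "product_topology (\<lambda>_. topol M) S"
  have "compact_space ?P" using M(3) by (simp add: compact_space_product_topology)
  moreover have "closedin ?P B" using cl by (simp add: power_top_def)
  ultimately have "compactin ?P B" by (rule closedin_compact_space)
  then have "compactin (subtopology ?P B) B" by (simp add: compactin_subtopology)
  then have "compactin (topol X) (k ` B)" by (rule image_compactin) (rule kc)
  moreover have "k ` B = carrier X"
  proof
    show "carrier X \<subseteq> k ` B"
    proof
      fix a assume "a \<in> carrier X"
      then show "a \<in> k ` B" using hB by (intro image_eqI[of _ k "h a"]) (simp_all add: kh)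
    qed
  qed (use kX in auto)
  ultimately show "compact_space (topol X)" using X(3) by (simp add: compact_space_def)
  \<comment> \<open>The coordinate of \<open>h\<close> at \<open>s\<close>, made extensional on the
    carrier of \<open>X\<close>.\<close>
  define p where "p s = (\<lambda>a\<in>carrier X. h a s)" for s
  have p: "p s \<in> chom X M" if s: "s \<in> S" for s
    unfolding chom_def mem_Collect_eq
  proof
    have "continuous_map (topol X) (topol M) (\<lambda>a. h a s)"
      using hc s by (auto simp: continuous_map_in_subtopology continuous_map_componentwise)
    then show "continuous_map (topol X) (topol M) (p s)"
      by (rule continuous_map_eq) (use X(3) in \<open>simp add: p_def\<close>)
    have mp: "map (p s) xs = map (\<lambda>x. x s) (map h xs)" if "xs \<in> tuples (carrier X) n" for xs n
      using that by (auto simp: tuples_def p_def)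
    show "p s \<in> hom X M"
      unfolding hom_def mem_Collect_eq
    proof (intro conjI ballI)
      show "p s \<in> carrier X \<rightarrow>\<^sub>E carrier M" using hB BP s by (auto simp: p_def)
    next
      fix f xs assume f: "f \<in> opsyms (sig X)" and xs: "xs \<in> tuples (carrier X) (opar (sig X) f)"
      have "h (opn X f xs) = opn (power_str M S) f (map h xs)"
        using homD_opn[OF h f xs] by (simp add: substr_simps)
      then show "p s (opn X f xs) = opn M f (map (p s) xs)"
        using is_structD_opn[OF X(2) f xs] s by (simp add: p_def power_str_def mp[OF xs, unfolded p_def])
    next
      fix r xs assume r: "r \<in> relsyms (sig X)" and xs: "xs \<in> rel X r"
      have "map h xs \<in> rel (power_str M S) r"
        using homD_rel[OF h r xs] by (simp add: substr_simps)
      then have "map (\<lambda>x. x s) (map h xs) \<in> rel M r" using s by (simp add: power_str_def)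
      then show "map (p s) xs \<in> rel M r" by (simp only: mp[OF is_structD_rel[OF X(2) r xs]])
    qed
  qed
  then show "chom X M \<noteq> {}" using S by blast
  show "separates_structure (chom X M) X M"
    unfolding separates_structure_def separates_points_def
  proof (intro conjI ballI impI)
    fix a b assume ab: "a \<in> carrier X" "b \<in> carrier X" "a \<noteq> b"
    then have "h a \<noteq> h b" using kh by metis
    moreover have "h a \<in> S \<rightarrow>\<^sub>E carrier M" "h b \<in> S \<rightarrow>\<^sub>E carrier M" using ab hB BP by auto
    ultimately obtain s where "s \<in> S" "h a s \<noteq> h b s" using PiE_ext[of "h a" S _ "h b"] by blast
    then show "\<exists>z\<in>chom X M. z a \<noteq> z b" using p ab by (intro bexI[of _ "p s"]) (auto simp: p_def)
  next
    fix r xs assume r: "r \<in> relsyms (sig X)" and xs: "xs \<in> tuples (carrier X) (relar (sig X) r)"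
      and nr: "xs \<notin> rel X r"
    have m: "map h xs \<in> tuples B (relar (sig M) r)" using map_in_tuples[OF xs hB] X(1) by simp
    have "map k (map h xs) = xs" using xs kh by (auto simp: tuples_def subset_iff intro!: map_idI)
    then have "map h xs \<notin> rel (substr (power_str M S) B) r"
      using homD_rel[OF k, of r "map h xs"] r X(1) nr by (auto simp: substr_simps power_str_simps)
    then have "map h xs \<notin> rel (power_str M S) r" using m by (auto simp: substr_simps tuples_def)
    moreover have "map h xs \<in> tuples (S \<rightarrow>\<^sub>E carrier M) (relar (sig M) r)"
      using m BP by (auto simp: tuples_def)
    ultimately obtain s where s: "s \<in> S" "map (\<lambda>x. x s) (map h xs) \<notin> rel M r"
      unfolding power_str_def by auto
    moreover have "map (p s) xs = map (\<lambda>x. x s) (map h xs)"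
      using xs by (auto simp: tuples_def p_def)
    ultimately show "\<exists>z\<in>chom X M. map z xs \<notin> rel M r" by (intro bexI[OF _ p[OF s(1)]]) (simp only: not_False_eq_True)
  qed
qed

text \<open>Converse of \<open>IScPD\<close>: evaluation at the members of \<open>Z\<close> maps
  \<open>X\<close> into the power with exponent \<open>Z\<close>. Separation makes this map
  injective and relation-reflecting; its image is compact in a Hausdorff space, hence closed. The
  two lemmas together reduce membership in the class to a separating set of morphisms.\<close>

lemma IScPI:
  fixes X :: "('x, 'f, 'r) topstruct"
  assumes X: "sig X = sig M" "is_struct X" "topspace (topol X) = carrier X" "compact_space (topol X)"
    and tM: "total_topstruct M"
    and Z: "Z \<subseteq> chom X M" "Z \<noteq> {}" and sep: "separates_structure Z X M"
  shows "X \<in> IScP M"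
proof -
  have M: "is_struct M" "topspace (topol M) = carrier M" "Hausdorff_space (topol M)"
    using tM by (simp_all add: total_topstruct_def total_structure_def)
  define h where "h = (\<lambda>x\<in>carrier X. \<lambda>z\<in>Z. z x)"
  define B where "B = h ` carrier X"
  let ?P = "product_topology (\<lambda>_. topol M) Z"
  have zh: "z \<in> hom X M" if "z \<in> Z" for z using that Z by (auto simp: chom_def)
  have hP: "h x \<in> Z \<rightarrow>\<^sub>E carrier M" if "x \<in> carrier X" for x
    using that homD_carrier[OF zh] by (auto simp: h_def)
  have hc: "continuous_map (topol X) ?P h"
    unfolding continuous_map_componentwise
  proof (intro conjI ballI)
    show "h ` topspace (topol X) \<subseteq> extensional Z" by (auto simp: h_def X(3))
    fix z assume z: "z \<in> Z"
    then have "continuous_map (topol X) (topol M) z" using Z by (auto simp: chom_def)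
    then show "continuous_map (topol X) (topol M) (\<lambda>x. h x z)"
      by (rule continuous_map_eq) (use z in \<open>simp add: h_def X(3)\<close>)
  qed
  have "compactin ?P B"
    unfolding B_def using image_compactin[OF _ hc] X(3,4) by (simp add: compact_space_def)
  moreover have HP: "Hausdorff_space ?P" using M(3) by (simp add: Hausdorff_space_product_topology)
  ultimately have cl: "closedin ?P B" by (rule compactin_imp_closedin[rotated])
  have inj: "inj_on h (carrier X)"
  proof (rule inj_onI, rule ccontr)
    fix x y assume xy: "x \<in> carrier X" "y \<in> carrier X" "h x = h y" "x \<noteq> y"
    then obtain z where "z \<in> Z" "z x \<noteq> z y"
      using sep unfolding separates_structure_def separates_points_def by blast
    then show False using xy by (metis (no_types, lifting) h_def restrict_apply')
  qed
  have mz: "map (\<lambda>y. y z) (map h xs) = map z xs" if "xs \<in> tuples (carrier X) n" "z \<in> Z" for xs n z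
    using that by (auto simp: tuples_def h_def)
  have hop: "h (opn X f xs) = opn (power_str M Z) f (map h xs)"
    if f: "f \<in> opsyms (sig X)" and xs: "xs \<in> tuples (carrier X) (opar (sig X) f)" for f xs
  proof
    fix z
    show "h (opn X f xs) z = opn (power_str M Z) f (map h xs) z"
    proof (cases "z \<in> Z")
      case True
      then have "h (opn X f xs) z = opn M f (map z xs)"
        using is_structD_opn[OF X(2) f xs] homD_opn[OF zh f xs] by (simp add: h_def)
      also have "\<dots> = opn M f (map (\<lambda>y. y z) (map h xs))" by (simp only: mz[OF xs True])
      finally show ?thesis using True by (simp add: power_str_def)
    next
      case False
      then show ?thesis
        using is_structD_opn[OF X(2) f xs] by (simp add: h_def power_str_def)
    qed
  qed
  have sub: "subuniverse (power_str M Z) B"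
    unfolding subuniverse_def power_str_simps
  proof (intro conjI ballI)
    show "B \<subseteq> Z \<rightarrow>\<^sub>E carrier M" using hP by (auto simp: B_def)
    fix f ys assume f: "f \<in> opsyms (sig M)" and ys: "ys \<in> tuples B (opar (sig M) f)"
    from ys obtain xs where xs: "xs \<in> tuples (carrier X) (opar (sig X) f)" "ys = map h xs"
      unfolding B_def tuples_image X(1) by blast
    then have "opn (power_str M Z) f ys = h (opn X f xs)" using hop f X(1) by simp
    then show "opn (power_str M Z) f ys \<in> B"
      using is_structD_opn[OF X(2) _ xs(1)] f X(1) by (simp add: B_def)
  qed
  let ?Y = "tsubstr (power_top M Z) B"
  have hr: "map h xs \<in> rel (power_str M Z) r \<longleftrightarrow> xs \<in> rel X r"
    if r: "r \<in> relsyms (sig X)" and xs: "xs \<in> tuples (carrier X) (relar (sig X) r)" for r xs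
  proof -
    have "map h xs \<in> tuples (Z \<rightarrow>\<^sub>E carrier M) (relar (sig M) r)"
      using map_in_tuples[OF xs hP] X(1) by simp
    then have "map h xs \<in> rel (power_str M Z) r \<longleftrightarrow> (\<forall>z\<in>Z. map z xs \<in> rel M r)"
      unfolding power_str_def using mz[OF xs] by (auto simp del: map_map)
    also have "\<dots> \<longleftrightarrow> xs \<in> rel X r"
      using sep r xs homD_rel[OF zh r] unfolding separates_structure_def by blast
    finally show ?thesis .
  qed
  have Y: "sig ?Y = sig M" "carrier ?Y = B" "topol ?Y = subtopology ?P B"
    "rel ?Y = rel (substr (power_str M Z) B)" "opn ?Y = opn (power_str M Z)"
    by (simp_all add: tsubstr_def power_top_def substr_def power_str_def)
  have "h \<in> hom X (substr (power_str M Z) B)"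
    unfolding hom_def mem_Collect_eq
  proof (intro conjI ballI)
    show "h \<in> carrier X \<rightarrow>\<^sub>E carrier (substr (power_str M Z) B)" by (auto simp: h_def B_def substr_simps)
  next
    fix f xs assume "f \<in> opsyms (sig X)" and "xs \<in> tuples (carrier X) (opar (sig X) f)"
    then show "h (opn X f xs) = opn (substr (power_str M Z) B) f (map h xs)"
      by (simp only: hop substr_simps)
  next
    fix r xs assume r: "r \<in> relsyms (sig X)" and xs: "xs \<in> rel X r"
    have t: "xs \<in> tuples (carrier X) (relar (sig X) r)" using is_structD_rel[OF X(2) r xs] .
    then show "map h xs \<in> rel (substr (power_str M Z) B) r"
      using hr[OF r t] xs by (auto simp: substr_simps B_def tuples_def)
  qed
  then have hY: "h \<in> chom X ?Y"
    using hc by (auto simp: chom_def tsubstr_power_top_simps continuous_map_in_subtopology X(3) B_def)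
  have "top_isomorphism X ?Y h"
  proof (rule top_isomorphismI[OF _ X(2) _ X(3) _ X(4) _ hY])
    show "sig X = sig ?Y" by (simp add: Y X(1))
    show "is_struct ?Y"
      unfolding is_struct_def Y
    proof (intro conjI ballI)
      fix f xs assume "f \<in> opsyms (sig M)" "xs \<in> tuples B (opar (sig M) f)"
      then show "opn (power_str M Z) f xs \<in> B"
        using sub unfolding subuniverse_def power_str_simps by blast
    next
      fix r show "rel (substr (power_str M Z) B) r \<subseteq> tuples B (relar (sig M) r)"
        by (auto simp: substr_simps power_str_def tuples_def)
    qed
    show "topspace (topol ?Y) = carrier ?Y"
      using closedin_subset[OF cl] by (auto simp: Y)
    show "Hausdorff_space (topol ?Y)" using HP by (simp add: Y Hausdorff_space_subtopology)
    show "bij_betw h (carrier X) (carrier ?Y)" using inj unfolding Y by (simp add: B_def bij_betw_def)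
    fix r xs assume "r \<in> relsyms (sig X)" "xs \<in> tuples (carrier X) (relar (sig X) r)"
      "map h xs \<in> rel ?Y r"
    then show "xs \<in> rel X r" using hr by (simp add: Y substr_simps)
  qed
  moreover have "closedin (topol (power_top M Z)) B" using cl by (simp add: power_top_def)
  moreover have "subuniverse (power_top M Z) B" using sub by (simp add: tsubstr_power_top_simps)
  ultimately show ?thesis using X Z(2) unfolding IScP_def by blast
qed


section \<open>The hom-functors\<close>

lemma Edual_simps:
  "sig (Edual M Mt X) = sig M" "carrier (Edual M Mt X) = chom X Mt"
  "opn (Edual M Mt X) f \<alpha>s = (\<lambda>x\<in>carrier X. opn M f (map (\<lambda>\<alpha>. \<alpha> x) \<alpha>s))"
  by (simp_all add: Edual_def substr_def power_str_def)

lemma Edual_rel: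
  assumes "carrier Mt = carrier M" and "\<alpha>s \<in> tuples (chom X Mt) (relar (sig M) r)"
  shows "\<alpha>s \<in> rel (Edual M Mt X) r \<longleftrightarrow> (\<forall>x\<in>carrier X. map (\<lambda>\<alpha>. \<alpha> x) \<alpha>s \<in> rel M r)"
proof -
  have "chom X Mt \<subseteq> carrier X \<rightarrow>\<^sub>E carrier M" using assms(1) by (auto simp: chom_def hom_def)
  then show ?thesis using assms(2) by (auto simp: Edual_def substr_def power_str_def tuples_def)
qed

lemma Dual_simps:
  "sig (Dual M Mt A) = sig Mt" "carrier (Dual M Mt A) = hom A M"
  "opn (Dual M Mt A) f us = (\<lambda>a\<in>carrier A. opn Mt f (map (\<lambda>u. u a) us))"
  "topol (Dual M Mt A) = subtopology (product_topology (\<lambda>_. topol Mt) (carrier A)) (hom A M)"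
  by (simp_all add: Dual_def tsubstr_def power_top_def substr_def power_str_def)

lemma Dual_rel:
  assumes "carrier Mt = carrier M" and "us \<in> tuples (hom A M) (relar (sig Mt) r)"
  shows "us \<in> rel (Dual M Mt A) r \<longleftrightarrow> (\<forall>a\<in>carrier A. map (\<lambda>u. u a) us \<in> rel Mt r)"
proof -
  have "hom A M \<subseteq> carrier A \<rightarrow>\<^sub>E carrier Mt" using assms(1) by (auto simp: hom_def)
  then show ?thesis
    using assms(2)
    by (auto simp: Dual_def tsubstr_def power_top_def substr_def power_str_def tuples_def)
qed

text \<open>The matrix with entries \<alpha>(x) has rows \<open>map \<alpha> xs\<close>. Reading it
  by columns turns the coordinatewise operation of \<open>npower\<close> into the pointwise
  operation on maps.\<close>

lemma map_nth_transpose: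
  assumes "length xs = m"
  shows "map (\<lambda>i. F (map (\<lambda>ys. ys ! i) (map (\<lambda>\<alpha>. map \<alpha> xs) \<alpha>s))) [0..<m] =
     map (\<lambda>x. F (map (\<lambda>\<alpha>. \<alpha> x) \<alpha>s)) xs"
  using assms by (intro nth_equalityI) (auto simp: comp_def)

text \<open>\<open>tuple_topology\<close> is pulled back from the product topology, so continuity
  into it is continuity in each coordinate.\<close>

lemma continuous_map_tuple:
  assumes "set \<alpha>s \<subseteq> {\<alpha>. continuous_map T U \<alpha>}" and "length \<alpha>s = n"
  shows "continuous_map T (tuple_topology U n) (\<lambda>x. map (\<lambda>\<alpha>. \<alpha> x) \<alpha>s)"
  unfolding tuple_topology_def
proof (rule continuous_map_pullback')
  show "topspace T \<subseteq> (\<lambda>x. map (\<lambda>\<alpha>. \<alpha> x) \<alpha>s) -` tuples (topspace U) n"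
    using assms by (auto simp: tuples_def continuous_map_def)
  show "continuous_map T (product_topology (\<lambda>_. U) {..<n})
     ((\<lambda>xs. \<lambda>i\<in>{..<n}. xs ! i) \<circ> (\<lambda>x. map (\<lambda>\<alpha>. \<alpha> x) \<alpha>s))"
    unfolding continuous_map_componentwise
  proof (intro conjI ballI)
    fix i assume i: "i \<in> {..<n}"
    then have "continuous_map T U (\<alpha>s ! i)" using assms by (auto simp: subset_iff)
    then show "continuous_map T U
        (\<lambda>x. ((\<lambda>xs. \<lambda>i\<in>{..<n}. xs ! i) \<circ> (\<lambda>x. map (\<lambda>\<alpha>. \<alpha> x) \<alpha>s)) x i)"
      by (rule continuous_map_eq) (use i assms(2) in auto)
  qed auto
qed

text \<open>Each clause of the alter ego condition contributes one property of the pointwise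
  operation. It commutes with the operations of \<open>Mt\<close> because these are homomorphisms on
  powers of \<open>M\<close>, preserves the relations of \<open>Mt\<close> because these are
  subuniverses of powers of \<open>M\<close>, and is continuous because the operations of
  \<open>M\<close> are. This makes \<open>chom X Mt\<close> closed under the operations of
  \<open>M\<close>.\<close>

lemma opn_in_chom:
  assumes M: "is_struct M" and ego: "alter_ego M Mt"
    and X: "sig X = sig Mt" "is_struct X" "topspace (topol X) = carrier X"
    and f: "f \<in> opsyms (sig M)" and \<alpha>s: "\<alpha>s \<in> tuples (chom X Mt) (opar (sig M) f)"
  shows "(\<lambda>x\<in>carrier X. opn M f (map (\<lambda>\<alpha>. \<alpha> x) \<alpha>s)) \<in> chom X Mt" (is "?\<beta> \<in> _")
proof -
  have car: "carrier Mt = carrier M"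
    and egor: "\<And>r. r \<in> relsyms (sig Mt) \<Longrightarrow> subuniverse (npower M (relar (sig Mt) r)) (rel Mt r)"
    and egog: "\<And>g. g \<in> opsyms (sig Mt) \<Longrightarrow>
        restrict (opn Mt g) (tuples (carrier M) (opar (sig Mt) g)) \<in> hom (npower M (opar (sig Mt) g)) M"
    and egoc: "continuous_map (tuple_topology (topol Mt) (opar (sig M) f)) (topol Mt) (opn M f)"
    using ego f by (auto simp: alter_ego_def operations_continuous_def)
  have \<alpha>: "\<alpha> \<in> hom X Mt" "continuous_map (topol X) (topol Mt) \<alpha>" if "\<alpha> \<in> set \<alpha>s" for \<alpha>
    using that \<alpha>s by (auto simp: tuples_def chom_def)
  have len: "length \<alpha>s = opar (sig M) f" using \<alpha>s by (simp add: tuples_def)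
  have at: "map (\<lambda>\<alpha>. \<alpha> x) \<alpha>s \<in> tuples (carrier M) (opar (sig M) f)" if "x \<in> carrier X" for x
    using homD_carrier[OF \<alpha>(1) that] len car by (auto simp: tuples_def)
  have m\<beta>: "map ?\<beta> xs = map (\<lambda>x. opn M f (map (\<lambda>\<alpha>. \<alpha> x) \<alpha>s)) xs"
    if "xs \<in> tuples (carrier X) n" for xs n
    using that by (auto simp: tuples_def)
  have np: "opn (npower M n) f (map (\<lambda>\<alpha>. map \<alpha> xs) \<alpha>s) = map ?\<beta> xs"
    if "xs \<in> tuples (carrier X) n" for xs n
  proof -
    have "length xs = n" using that by (simp add: tuples_def)
    from map_nth_transpose[OF this, of "opn M f" \<alpha>s] show ?thesis
      unfolding m\<beta>[OF that] by (simp add: npower_def)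
  qed
  have "?\<beta> \<in> hom X Mt"
    unfolding hom_def mem_Collect_eq
  proof (intro conjI ballI)
    show "?\<beta> \<in> carrier X \<rightarrow>\<^sub>E carrier Mt"
      using is_structD_opn[OF M f at] car by auto
  next
    fix g xs assume gX: "g \<in> opsyms (sig X)" and xs: "xs \<in> tuples (carrier X) (opar (sig X) g)"
    let ?n = "opar (sig Mt) g"
    have g: "g \<in> opsyms (sig Mt)" using gX X(1) by simp
    have xs': "xs \<in> tuples (carrier X) ?n" using xs X(1) by simp
    have mt: "map \<alpha> xs \<in> tuples (carrier M) ?n" if "\<alpha> \<in> set \<alpha>s" for \<alpha>
      using map_in_tuples[OF xs' homD_carrier[OF \<alpha>(1)[OF that]]] car by simp
    have yss: "map (\<lambda>\<alpha>. map \<alpha> xs) \<alpha>s \<in> tuples (carrier (npower M ?n)) (opar (sig (npower M ?n)) f)"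
      using mt len by (force simp: tuples_def npower_def)
    have fn: "f \<in> opsyms (sig (npower M ?n))" using f by (simp add: npower_def)
    \<comment> \<open>The alter ego condition concerns \<open>opn Mt g\<close> restricted to tuples
      over \<open>M\<close>; this membership allows the restriction to be dropped at the
      argument.\<close>
    have "map ?\<beta> xs \<in> tuples (carrier M) ?n"
      unfolding m\<beta>[OF xs'] using xs' is_structD_opn[OF M f at] by (auto simp: tuples_def)
    then have "opn Mt g (map ?\<beta> xs) =
        restrict (opn Mt g) (tuples (carrier M) ?n) (opn (npower M ?n) f (map (\<lambda>\<alpha>. map \<alpha> xs) \<alpha>s))"
      by (simp only: np[OF xs'] restrict_apply')
    also have "\<dots> = opn M f (map (restrict (opn Mt g) (tuples (carrier M) ?n)) (map (\<lambda>\<alpha>. map \<alpha> xs) \<alpha>s))"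
      by (rule homD_opn[OF egog[OF g] fn yss])
    also have "map (restrict (opn Mt g) (tuples (carrier M) ?n)) (map (\<lambda>\<alpha>. map \<alpha> xs) \<alpha>s)
        = map (\<lambda>\<alpha>. \<alpha> (opn X g xs)) \<alpha>s"
      using mt homD_opn[OF \<alpha>(1) gX xs] by auto
    also have "opn M f \<dots> = ?\<beta> (opn X g xs)"
      using is_structD_opn[OF X(2) gX xs] by simp
    finally show "?\<beta> (opn X g xs) = opn Mt g (map ?\<beta> xs)" ..
  next
    fix r xs assume rX: "r \<in> relsyms (sig X)" and xs: "xs \<in> rel X r"
    let ?n = "relar (sig Mt) r"
    have r: "r \<in> relsyms (sig Mt)" using rX X(1) by simp
    have xs': "xs \<in> tuples (carrier X) ?n" using is_structD_rel[OF X(2) rX xs] X(1) by simp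
    have yss: "map (\<lambda>\<alpha>. map \<alpha> xs) \<alpha>s \<in> tuples (rel Mt r) (opar (sig (npower M ?n)) f)"
      using homD_rel[OF \<alpha>(1) rX xs] len by (auto simp: tuples_def npower_def)
    have fn: "f \<in> opsyms (sig (npower M ?n))" using f by (simp add: npower_def)
    have "opn (npower M ?n) f (map (\<lambda>\<alpha>. map \<alpha> xs) \<alpha>s) \<in> rel Mt r"
      using egor[OF r] fn yss unfolding subuniverse_def by blast
    then show "map ?\<beta> xs \<in> rel Mt r" by (simp only: np[OF xs'])
  qed
  moreover have "continuous_map (topol X) (topol Mt) ?\<beta>"
  proof -
    have "continuous_map (topol X) (tuple_topology (topol Mt) (opar (sig M) f))
        (\<lambda>x. map (\<lambda>\<alpha>. \<alpha> x) \<alpha>s)"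
      by (rule continuous_map_tuple) (use \<alpha>(2) len in auto)
    from continuous_map_compose[OF this egoc]
    show ?thesis by (rule continuous_map_eq) (auto simp: X(3))
  qed
  ultimately show ?thesis by (simp add: chom_def)
qed

text \<open>Operations and relations of the dual are pointwise, so evaluating at \<open>x\<close>
  respects them. The closure assumption \<open>cl\<close> keeps the value of an operation inside the
  domain on which the evaluation map is not \<open>undefined\<close>.\<close>

lemma evaluation_hom:
  assumes "carrier Mt = carrier M" and "x \<in> carrier X"
    and cl: "\<And>f \<alpha>s. f \<in> opsyms (sig M) \<Longrightarrow> \<alpha>s \<in> tuples (chom X Mt) (opar (sig M) f) \<Longrightarrow>
               opn (Edual M Mt X) f \<alpha>s \<in> chom X Mt"
  shows "(\<lambda>\<alpha>\<in>chom X Mt. \<alpha> x) \<in> hom (Edual M Mt X) M" (is "?e \<in> _")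
proof -
  have e: "map ?e \<alpha>s = map (\<lambda>\<alpha>. \<alpha> x) \<alpha>s" if "set \<alpha>s \<subseteq> chom X Mt" for \<alpha>s
    using that by auto
  show ?thesis
    unfolding hom_def mem_Collect_eq Edual_simps(1,2)
  proof (intro conjI ballI)
    show "?e \<in> chom X Mt \<rightarrow>\<^sub>E carrier M"
      using assms(1,2) by (auto simp: chom_def intro: homD_carrier)
  next
    fix f \<alpha>s assume "f \<in> opsyms (sig M)" "\<alpha>s \<in> tuples (chom X Mt) (opar (sig M) f)"
    then have "opn (Edual M Mt X) f \<alpha>s \<in> chom X Mt" "set \<alpha>s \<subseteq> chom X Mt"
      using cl by (auto simp: tuples_def)
    then show "?e (opn (Edual M Mt X) f \<alpha>s) = opn M f (map ?e \<alpha>s)"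
      using assms(2) unfolding e[OF \<open>set \<alpha>s \<subseteq> _\<close>] by (simp add: Edual_simps)
  next
    fix r \<alpha>s assume "\<alpha>s \<in> rel (Edual M Mt X) r"
    then have "set \<alpha>s \<subseteq> chom X Mt" "map (\<lambda>\<alpha>. \<alpha> x) \<alpha>s \<in> rel M r"
      using assms(2) by (auto simp: Edual_def substr_def power_str_def)
    then show "map ?e \<alpha>s \<in> rel M r" by (simp only: e)
  qed
qed

lemma is_struct_Edual:
  assumes "\<And>f \<alpha>s. f \<in> opsyms (sig M) \<Longrightarrow> \<alpha>s \<in> tuples (chom X Mt) (opar (sig M) f) \<Longrightarrow>
     opn (Edual M Mt X) f \<alpha>s \<in> chom X Mt"
  shows "is_struct (Edual M Mt X)"
  using assms unfolding is_struct_def Edual_simps(1,2)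
  by (auto simp: Edual_def substr_def power_str_def tuples_def)

text \<open>Separation of \<open>X\<close> by its morphisms into \<open>Mt\<close> gives injectivity
  and reflection of relations, and compactness gives continuity of the inverse. Surjectivity alone
  is left as the obligation \<open>surj\<close>, to be met by piggybacking.\<close>

lemma top_isomorphism_evaluation:
  assumes M: "is_struct M" and Mt: "total_topstruct Mt" and ego: "alter_ego M Mt"
    and X: "X \<in> IScP Mt"
    and surj: "\<And>u. u \<in> hom (Edual M Mt X) M \<Longrightarrow> \<exists>x\<in>carrier X. \<forall>\<alpha>\<in>chom X Mt. u \<alpha> = \<alpha> x"
  shows "top_isomorphism X (Dual M Mt (Edual M Mt X)) (\<lambda>x\<in>carrier X. \<lambda>\<alpha>\<in>chom X Mt. \<alpha> x)"
    (is "top_isomorphism X ?D ?\<epsilon>")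
proof -
  note XD = IScPD[OF X Mt]
  have Mt': "is_struct Mt" "topspace (topol Mt) = carrier Mt" "Hausdorff_space (topol Mt)"
    using Mt by (simp_all add: total_topstruct_def total_structure_def)
  have car: "carrier Mt = carrier M" using ego by (simp add: alter_ego_def)
  have cl: "opn (Edual M Mt X) f \<alpha>s \<in> chom X Mt"
    if "f \<in> opsyms (sig M)" "\<alpha>s \<in> tuples (chom X Mt) (opar (sig M) f)" for f \<alpha>s
    using opn_in_chom[OF M ego XD(1-3) that] by (simp add: Edual_simps)
  let ?H = "hom (Edual M Mt X) M"
  have ev: "(\<lambda>\<alpha>\<in>chom X Mt. \<alpha> x) \<in> ?H" if "x \<in> carrier X" for x
    using evaluation_hom[OF car that cl] .
  have image: "?\<epsilon> ` carrier X = ?H"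
  proof
    show "?\<epsilon> ` carrier X \<subseteq> ?H" using ev by auto
    show "?H \<subseteq> ?\<epsilon> ` carrier X"
    proof
      fix u assume u: "u \<in> ?H"
      then obtain x where x: "x \<in> carrier X" "\<forall>\<alpha>\<in>chom X Mt. u \<alpha> = \<alpha> x" using surj by blast
      \<comment> \<open>Both sides are extensional on \<open>chom X Mt\<close>, so agreement there
        is equality of functions.\<close>
      have "u = ?\<epsilon> x"
        using x u by (auto simp: hom_def PiE_def extensional_def Edual_simps fun_eq_iff)
      then show "u \<in> ?\<epsilon> ` carrier X" using x(1) by blast
    qed
  qed
  have inj: "inj_on ?\<epsilon> (carrier X)"
  proof (rule inj_onI, rule ccontr)
    fix x y assume xy: "x \<in> carrier X" "y \<in> carrier X" "?\<epsilon> x = ?\<epsilon> y" "x \<noteq> y"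
    then obtain \<alpha> where \<alpha>: "\<alpha> \<in> chom X Mt" "\<alpha> x \<noteq> \<alpha> y"
      using XD(6) unfolding separates_structure_def separates_points_def by blast
    have "?\<epsilon> x \<alpha> = ?\<epsilon> y \<alpha>" by (simp only: xy(3))
    then show False using \<alpha> xy(1,2) by simp
  qed
  have at: "map (\<lambda>u. u \<alpha>) (map ?\<epsilon> xs) = map \<alpha> xs"
    if "xs \<in> tuples (carrier X) n" "\<alpha> \<in> chom X Mt" for xs n \<alpha>
    using that by (auto simp: tuples_def)
  have relD: "map ?\<epsilon> xs \<in> rel ?D r \<longleftrightarrow> xs \<in> rel X r"
    if r: "r \<in> relsyms (sig X)" and xs: "xs \<in> tuples (carrier X) (relar (sig X) r)" for r xs
  proof -
    have "map ?\<epsilon> xs \<in> tuples ?H (relar (sig Mt) r)"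
      using xs ev XD(1) by (auto simp: tuples_def)
    then have "map ?\<epsilon> xs \<in> rel ?D r \<longleftrightarrow> (\<forall>\<alpha>\<in>chom X Mt. map \<alpha> xs \<in> rel Mt r)"
      using at[OF xs] by (simp add: Dual_rel[OF car] Edual_simps del: map_map)
    also have "\<dots> \<longleftrightarrow> xs \<in> rel X r"
      using XD(6) r xs homD_rel[of _ X Mt r xs] unfolding separates_structure_def chom_def by blast
    finally show ?thesis .
  qed
  have \<epsilon>op: "?\<epsilon> (opn X f xs) = opn ?D f (map ?\<epsilon> xs)"
    if f: "f \<in> opsyms (sig X)" and xs: "xs \<in> tuples (carrier X) (opar (sig X) f)" for f xs
  proof
    fix \<alpha>
    show "?\<epsilon> (opn X f xs) \<alpha> = opn ?D f (map ?\<epsilon> xs) \<alpha>"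
    proof (cases "\<alpha> \<in> chom X Mt")
      case True
      then have "?\<epsilon> (opn X f xs) \<alpha> = opn Mt f (map \<alpha> xs)"
        using is_structD_opn[OF XD(2) f xs] homD_opn[OF _ f xs, of \<alpha> Mt] by (simp add: chom_def)
      also have "\<dots> = opn Mt f (map (\<lambda>u. u \<alpha>) (map ?\<epsilon> xs))" by (simp only: at[OF xs True])
      finally show ?thesis using True by (simp add: Dual_simps Edual_simps)
    next
      case False
      then show ?thesis
        using is_structD_opn[OF XD(2) f xs] by (simp add: Dual_simps Edual_simps)
    qed
  qed
  have "?\<epsilon> \<in> hom X ?D"
    unfolding hom_def mem_Collect_eq
  proof (intro conjI ballI)
    show "?\<epsilon> \<in> carrier X \<rightarrow>\<^sub>E carrier ?D" using ev by (simp add: Dual_simps)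
    show "?\<epsilon> (opn X f xs) = opn ?D f (map ?\<epsilon> xs)"
      if "f \<in> opsyms (sig X)" "xs \<in> tuples (carrier X) (opar (sig X) f)" for f xs
      using \<epsilon>op[OF that] .
    show "map ?\<epsilon> xs \<in> rel ?D r" if "r \<in> relsyms (sig X)" "xs \<in> rel X r" for r xs
      using relD[OF that(1) is_structD_rel[OF XD(2) that]] that(2) by blast
  qed
  moreover have "continuous_map (topol X) (product_topology (\<lambda>_. topol Mt) (chom X Mt)) ?\<epsilon>"
    unfolding continuous_map_componentwise
  proof (intro conjI ballI)
    fix \<alpha> assume \<alpha>: "\<alpha> \<in> chom X Mt"
    then have "continuous_map (topol X) (topol Mt) \<alpha>" by (simp add: chom_def)
    then show "continuous_map (topol X) (topol Mt) (\<lambda>x. ?\<epsilon> x \<alpha>)"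
      by (rule continuous_map_eq) (use \<alpha> XD(3) in simp)
  qed (auto simp: XD(3))
  ultimately have \<epsilon>: "?\<epsilon> \<in> chom X ?D"
    using ev by (auto simp: chom_def Dual_simps Edual_simps continuous_map_in_subtopology XD(3))
  \<comment> \<open>By surjectivity every tuple in the double dual is a tuple of evaluations. The
    operation sends it to evaluation at the value of the same operation in \<open>X\<close>.\<close>
  have D_op: "opn ?D f us \<in> ?H"
    if f: "f \<in> opsyms (sig Mt)" and us: "us \<in> tuples ?H (opar (sig Mt) f)" for f us
  proof -
    obtain xs where xs: "xs \<in> tuples (carrier X) (opar (sig X) f)" "us = map ?\<epsilon> xs"
      using us unfolding image[symmetric] tuples_image XD(1) by blast
    have "opn ?D f us = ?\<epsilon> (opn X f xs)" using \<epsilon>op[OF _ xs(1)] f XD(1) xs(2) by simp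
    then show ?thesis
      using ev is_structD_opn[OF XD(2) _ xs(1)] f XD(1) by simp
  qed
  show ?thesis
  proof (rule top_isomorphismI[OF _ XD(2) _ XD(3) _ XD(4) _ \<epsilon>])
    show "sig X = sig ?D" by (simp add: XD(1) Dual_simps)
    show "is_struct ?D"
      unfolding is_struct_def Dual_simps(1,2)
    proof (intro conjI ballI)
      fix r show "rel ?D r \<subseteq> tuples ?H (relar (sig Mt) r)"
        by (auto simp: Dual_def tsubstr_def power_top_def substr_def power_str_def tuples_def)
    qed (rule D_op)
    show "topspace (topol ?D) = carrier ?D"
      using Mt'(2) car by (auto simp: Dual_simps hom_def Edual_simps)
    show "Hausdorff_space (topol ?D)"
      unfolding Dual_simps
      by (intro Hausdorff_space_subtopology) (simp add: Hausdorff_space_product_topology Mt'(3))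
    show "bij_betw ?\<epsilon> (carrier X) (carrier ?D)"
      using inj image by (simp add: Dual_simps bij_betw_def)
    show "xs \<in> rel X r" if "r \<in> relsyms (sig X)" "xs \<in> tuples (carrier X) (relar (sig X) r)"
      "map ?\<epsilon> xs \<in> rel ?D r" for r xs
      using relD[OF that(1,2)] that(3) by blast
  qed
qed


section \<open>Structural reducts of structures with topology\<close>

text \<open>This is \<open>X\<^sup>b\<close> of the outline: a recipe assigning a term to each
  operation symbol and a set of atomic formulas to each relation symbol, carried out in
  \<open>X\<close>. The recipe comes from the reduct of \<open>Mt\<close> and applies to every
  \<open>X\<close> of the same type.\<close>

definition reduct_str ::
  "('x, 'f, 'r) topstruct \<Rightarrow> ('g, 'q) signature \<Rightarrow> ('g \<Rightarrow> 'f trm) \<Rightarrow> ('q \<Rightarrow> ('f, 'r) atomic set) \<Rightarrow>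
     ('x, 'g, 'q) topstruct" where
  "reduct_str X \<Sigma> \<tau> \<Phi> =
     \<lparr>sig = \<Sigma>, carrier = carrier X, opn = (\<lambda>g xs. eval_trm X xs (\<tau> g)),
      rel = (\<lambda>r. {xs \<in> tuples (carrier X) (relar \<Sigma> r). \<forall>\<phi>\<in>\<Phi> r. sat_atomic X xs \<phi>}),
      topol = topol X\<rparr>"

text \<open>\<open>structural_reduct\<close> only asserts that suitable terms and formulas exist.
  Here they are named, so that the recipe found in \<open>Mt\<close> can be transported to other
  structures.\<close>

definition presents ::
  "('a, 'f, 'r, 'z) relstruct_scheme \<Rightarrow> ('a, 'g, 'q, 'w) relstruct_scheme \<Rightarrow>
     ('g \<Rightarrow> 'f trm) \<Rightarrow> ('q \<Rightarrow> ('f, 'r) atomic set) \<Rightarrow> bool" where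
  "presents A A' \<tau> \<Phi> \<longleftrightarrow> carrier A' = carrier A \<and>
     (\<forall>g\<in>opsyms (sig A'). wf_trm (sig A) (opar (sig A') g) (\<tau> g) \<and>
        (\<forall>xs\<in>tuples (carrier A) (opar (sig A') g). opn A' g xs = eval_trm A xs (\<tau> g))) \<and>
     (\<forall>r\<in>relsyms (sig A'). (\<forall>\<phi>\<in>\<Phi> r. wf_atomic (sig A) (relar (sig A') r) \<phi>) \<and>
        rel A' r = {xs \<in> tuples (carrier A) (relar (sig A') r). \<forall>\<phi>\<in>\<Phi> r. sat_atomic A xs \<phi>})"

lemma structural_reduct_presents:
  assumes "structural_reduct A A'"
  obtains \<tau> \<Phi> where "presents A A' \<tau> \<Phi>"
proof -
  have "\<forall>g\<in>opsyms (sig A'). \<exists>t. wf_trm (sig A) (opar (sig A') g) t \<and>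
      (\<forall>xs\<in>tuples (carrier A) (opar (sig A') g). opn A' g xs = eval_trm A xs t)"
  proof
    fix g assume "g \<in> opsyms (sig A')"
    then obtain t where t: "wf_trm (sig A) (opar (sig A') g) t"
      "restrict (opn A' g) (tuples (carrier A) (opar (sig A') g)) =
       restrict (\<lambda>xs. eval_trm A xs t) (tuples (carrier A) (opar (sig A') g))"
      using assms unfolding structural_reduct_def by (auto simp only: term_functions_def)
    show "\<exists>t. wf_trm (sig A) (opar (sig A') g) t \<and>
      (\<forall>xs\<in>tuples (carrier A) (opar (sig A') g). opn A' g xs = eval_trm A xs t)"
    proof (intro exI conjI ballI)
      fix xs assume "xs \<in> tuples (carrier A) (opar (sig A') g)"
      then show "opn A' g xs = eval_trm A xs t" using fun_cong[OF t(2), of xs] by simp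
    qed (rule t(1))
  qed
  then obtain \<tau> where \<tau>: "\<forall>g\<in>opsyms (sig A'). wf_trm (sig A) (opar (sig A') g) (\<tau> g) \<and>
      (\<forall>xs\<in>tuples (carrier A) (opar (sig A') g). opn A' g xs = eval_trm A xs (\<tau> g))"
    by (rule bchoice[THEN exE])
  have "\<forall>r\<in>relsyms (sig A'). \<exists>\<Phi>. (\<forall>\<phi>\<in>\<Phi>. wf_atomic (sig A) (relar (sig A') r) \<phi>) \<and>
      rel A' r = {xs \<in> tuples (carrier A) (relar (sig A') r). \<forall>\<phi>\<in>\<Phi>. sat_atomic A xs \<phi>}"
    using assms unfolding structural_reduct_def conjunct_atomic_definable_def by blast
  then obtain \<Phi> where "\<forall>r\<in>relsyms (sig A'). (\<forall>\<phi>\<in>\<Phi> r. wf_atomic (sig A) (relar (sig A') r) \<phi>) \<and>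
      rel A' r = {xs \<in> tuples (carrier A) (relar (sig A') r). \<forall>\<phi>\<in>\<Phi> r. sat_atomic A xs \<phi>}"
    by (rule bchoice[THEN exE])
  with \<tau> assms show thesis
    by (intro that[of \<tau> \<Phi>]) (simp add: presents_def structural_reduct_def)
qed

lemma reduct_str_simps:
  "sig (reduct_str X \<Sigma> \<tau> \<Phi>) = \<Sigma>" "carrier (reduct_str X \<Sigma> \<tau> \<Phi>) = carrier X"
  "opn (reduct_str X \<Sigma> \<tau> \<Phi>) g xs = eval_trm X xs (\<tau> g)"
  "topol (reduct_str X \<Sigma> \<tau> \<Phi>) = topol X"
  "xs \<in> rel (reduct_str X \<Sigma> \<tau> \<Phi>) r \<longleftrightarrow>
     xs \<in> tuples (carrier X) (relar \<Sigma> r) \<and> (\<forall>\<phi>\<in>\<Phi> r. sat_atomic X xs \<phi>)"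
  by (simp_all add: reduct_str_def)

lemma hom_reduct_str:
  assumes "presents A A' \<tau> \<Phi>" and "sig X = sig A" and "is_struct X" and z: "z \<in> hom X A"
  shows "z \<in> hom (reduct_str X (sig A') \<tau> \<Phi>) A'"
  unfolding hom_def mem_Collect_eq reduct_str_simps(1,2)
proof (intro conjI ballI)
  show "z \<in> carrier X \<rightarrow>\<^sub>E carrier A'" using z assms(1) by (simp add: hom_def presents_def)
next
  fix g xs assume g: "g \<in> opsyms (sig A')" and xs: "xs \<in> tuples (carrier X) (opar (sig A') g)"
  have "map z xs \<in> tuples (carrier A) (opar (sig A') g)"
    using map_in_tuples[OF xs homD_carrier[OF z]] .
  then show "z (opn (reduct_str X (sig A') \<tau> \<Phi>) g xs) = opn A' g (map z xs)"
    using g assms(1,2) hom_eval_trm[OF z assms(3) xs, of "\<tau> g"]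
    by (simp add: presents_def reduct_str_simps)
next
  fix r xs assume r: "r \<in> relsyms (sig A')" and "xs \<in> rel (reduct_str X (sig A') \<tau> \<Phi>) r"
  then have xs: "xs \<in> tuples (carrier X) (relar (sig A') r)" "\<forall>\<phi>\<in>\<Phi> r. sat_atomic X xs \<phi>"
    by (simp_all add: reduct_str_simps)
  have "map z xs \<in> tuples (carrier A) (relar (sig A') r)"
    using map_in_tuples[OF xs(1) homD_carrier[OF z]] .
  moreover have "\<forall>\<phi>\<in>\<Phi> r. sat_atomic A (map z xs) \<phi>"
    using xs r assms(1,2) hom_sat_atomic[OF z assms(3) xs(1)] by (simp add: presents_def)
  ultimately show "map z xs \<in> rel A' r" using r assms(1) by (simp add: presents_def)
qed

lemma hom_compose:
  assumes "h \<in> hom A B" "k \<in> hom B C" and "sig A = sig B" and "is_struct A"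
  shows "(\<lambda>a\<in>carrier A. k (h a)) \<in> hom A C"
proof -
  have m: "map (\<lambda>a\<in>carrier A. k (h a)) xs = map k (map h xs)" if "xs \<in> tuples (carrier A) n" for xs n
    using that by (auto simp: tuples_def)
  show ?thesis
    unfolding hom_def mem_Collect_eq
  proof (intro conjI ballI)
    show "(\<lambda>a\<in>carrier A. k (h a)) \<in> carrier A \<rightarrow>\<^sub>E carrier C"
      using homD_carrier[OF assms(1)] homD_carrier[OF assms(2)] by auto
  next
    fix f xs assume f: "f \<in> opsyms (sig A)" and xs: "xs \<in> tuples (carrier A) (opar (sig A) f)"
    have "map h xs \<in> tuples (carrier B) (opar (sig B) f)"
      using map_in_tuples[OF xs homD_carrier[OF assms(1)]] assms(3) by simp
    then have "k (h (opn A f xs)) = opn C f (map k (map h xs))"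
      using homD_opn[OF assms(1) f xs] homD_opn[OF assms(2)] f assms(3) by simp
    then show "(\<lambda>a\<in>carrier A. k (h a)) (opn A f xs) = opn C f (map (\<lambda>a\<in>carrier A. k (h a)) xs)"
      unfolding m[OF xs] using is_structD_opn[OF assms(4) f xs] by simp
  next
    fix r xs assume r: "r \<in> relsyms (sig A)" and xs: "xs \<in> rel A r"
    show "map (\<lambda>a\<in>carrier A. k (h a)) xs \<in> rel C r"
      unfolding m[OF is_structD_rel[OF assms(4) r xs]]
      using homD_rel[OF assms(2) _ homD_rel[OF assms(1) r xs]] r assms(3) by simp
  qed
qed

lemma chom_compose:
  assumes "h \<in> chom X Y" "k \<in> chom Y Z" and "sig X = sig Y" and "is_struct X"
    and "topspace (topol X) = carrier X"
  shows "(\<lambda>x\<in>carrier X. k (h x)) \<in> chom X Z"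
proof -
  have "continuous_map (topol X) (topol Z) (k \<circ> h)"
    using assms(1,2) by (auto simp: chom_def intro: continuous_map_compose)
  then have "continuous_map (topol X) (topol Z) (\<lambda>x\<in>carrier X. k (h x))"
    by (rule continuous_map_eq) (simp add: assms(5))
  then show ?thesis using assms hom_compose[of h X Y k Z] by (simp add: chom_def)
qed

lemma is_struct_reduct_str:
  assumes "presents A A' \<tau> \<Phi>" and "sig X = sig A" and "is_struct X"
  shows "is_struct (reduct_str X (sig A') \<tau> \<Phi>)"
  unfolding is_struct_def reduct_str_simps(1-3)
proof (intro conjI ballI)
  fix g xs assume "g \<in> opsyms (sig A')" "xs \<in> tuples (carrier X) (opar (sig A') g)"
  then show "eval_trm X xs (\<tau> g) \<in> carrier X"
    using eval_trm_in_carrier[OF assms(3)] assms(1,2) by (auto simp: presents_def)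
qed (auto simp: reduct_str_simps)

lemma chom_reduct_str:
  assumes "presents Mt Mtb \<tau> \<Phi>" and "topol Mtb = topol Mt" and "sig X = sig Mt" and "is_struct X"
    and "z \<in> chom X Mt"
  shows "z \<in> chom (reduct_str X (sig Mtb) \<tau> \<Phi>) Mtb"
  using hom_reduct_str[OF assms(1,3,4)] assms(2,5) by (simp add: chom_def reduct_str_simps)

text \<open>The morphisms from \<open>X\<close> to \<open>Mt\<close> followed by those from
  \<open>Mtb\<close> to \<open>Nt\<close> form the separating set \<open>Z\<close> required by
  \<open>IScPI\<close>.\<close>

lemma reduct_str_IScP:
  fixes X :: "('x, 'f, 'r) topstruct"
  assumes Mt: "total_topstruct Mt" and Nt: "total_topstruct Nt"
    and pres: "presents Mt Mtb \<tau> \<Phi>" and top: "topol Mtb = topol Mt" and Mtb: "Mtb \<in> IScP Nt"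
    and X: "X \<in> IScP Mt"
  shows "reduct_str X (sig Mtb) \<tau> \<Phi> \<in> IScP Nt" (is "?X \<in> _")
proof -
  note XD = IScPD[OF X Mt] and BD = IScPD[OF Mtb Nt]
  have str: "is_struct ?X" using is_struct_reduct_str[OF pres XD(1,2)] .
  have car: "carrier Mtb = carrier Mt" using pres by (simp add: presents_def)
  define Z where "Z = {\<lambda>x\<in>carrier X. \<zeta> (z x) | \<zeta> z. \<zeta> \<in> chom Mtb Nt \<and> z \<in> chom X Mt}"
  have zh: "z \<in> hom X Mt" if "z \<in> chom X Mt" for z using that by (simp add: chom_def)
  show ?thesis
  proof (rule IScPI[of ?X, OF _ str _ _ Nt])
    show "sig ?X = sig Nt" using BD(1) by (simp add: reduct_str_simps)
    show "topspace (topol ?X) = carrier ?X" "compact_space (topol ?X)"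
      using XD(3,4) by (simp_all add: reduct_str_simps)
    show "Z \<subseteq> chom ?X Nt"
    proof
      fix y assume "y \<in> Z"
      then obtain \<zeta> z where y: "y = (\<lambda>x\<in>carrier ?X. \<zeta> (z x))" "\<zeta> \<in> chom Mtb Nt" "z \<in> chom X Mt"
        unfolding Z_def reduct_str_simps by blast
      show "y \<in> chom ?X Nt"
        unfolding y(1)
        using chom_compose[OF chom_reduct_str[OF pres top XD(1,2) y(3)] y(2) _ str] XD(3)
        by (simp add: reduct_str_simps)
    qed
    show "Z \<noteq> {}" using XD(5) BD(5) unfolding Z_def by blast
    show "separates_structure Z ?X Nt"
      unfolding separates_structure_def separates_points_def reduct_str_simps(1,2)
    proof (intro conjI ballI impI)
      fix a b assume ab: "a \<in> carrier X" "b \<in> carrier X" "a \<noteq> b"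
      then obtain z where z: "z \<in> chom X Mt" "z a \<noteq> z b"
        using XD(6) unfolding separates_structure_def separates_points_def by blast
      then have "z a \<in> carrier Mtb" "z b \<in> carrier Mtb" using ab homD_carrier[OF zh] car by auto
      then obtain \<zeta> where \<zeta>: "\<zeta> \<in> chom Mtb Nt" "\<zeta> (z a) \<noteq> \<zeta> (z b)"
        using z(2) BD(6) unfolding separates_structure_def separates_points_def by blast
      show "\<exists>y\<in>Z. y a \<noteq> y b"
        by (rule bexI[of _ "\<lambda>x\<in>carrier X. \<zeta> (z x)"]) (use ab z \<zeta> in \<open>auto simp: Z_def\<close>)
    next
      fix r xs assume r: "r \<in> relsyms (sig Mtb)" and xs: "xs \<in> tuples (carrier X) (relar (sig Mtb) r)"
        and n: "xs \<notin> rel ?X r"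
      then obtain \<phi> where \<phi>: "\<phi> \<in> \<Phi> r" "\<not> sat_atomic X xs \<phi>" by (auto simp: reduct_str_simps)
      have wf: "wf_atomic (sig X) (relar (sig Mtb) r) \<phi>"
        using pres r \<phi>(1) XD(1) by (simp add: presents_def)
      \<comment> \<open>A tuple outside a relation of the reduct violates some atomic formula of its
        definition. Some \<open>z\<close> sees the violation in \<open>Mt\<close>, so the image
        tuple lies outside that relation of \<open>Mtb\<close>, and then some \<zeta> sees this in
        \<open>Nt\<close>.\<close>
      obtain z where z: "z \<in> chom X Mt" "\<not> sat_atomic Mt (map z xs) \<phi>"
        using separating_homs_sat_atomic[OF XD(2) _ XD(6) xs wf] \<phi>(2) zh by blast
      have "map z xs \<notin> rel Mtb r" using z(2) \<phi>(1) r pres by (auto simp: presents_def)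
      moreover have "map z xs \<in> tuples (carrier Mtb) (relar (sig Mtb) r)"
        using map_in_tuples[OF xs homD_carrier[OF zh[OF z(1)]]] car by simp
      ultimately obtain \<zeta> where \<zeta>: "\<zeta> \<in> chom Mtb Nt" "map \<zeta> (map z xs) \<notin> rel Nt r"
        using BD(6) r unfolding separates_structure_def by blast
      have "map (\<lambda>x\<in>carrier X. \<zeta> (z x)) xs = map \<zeta> (map z xs)" using xs by (auto simp: tuples_def)
      with \<zeta> z(1) show "\<exists>y\<in>Z. map y xs \<notin> rel Nt r"
        by (intro bexI[of _ "\<lambda>x\<in>carrier X. \<zeta> (z x)"]) (auto simp: Z_def simp del: map_map)
    qed
  qed
qed


section \<open>Maximal substructures and entailment\<close>

text \<open>Zorn's lemma: operations are finitary, so the union of a chain of subuniverses is a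
  subuniverse.\<close>

lemma maximal_sub_exists:
  assumes "subuniverse (npower A n) s0" and "s0 \<subseteq> P"
  obtains s where "s0 \<subseteq> s" and "maximal_sub A n P s"
proof -
  define F where "F = {s. subuniverse (npower A n) s \<and> s0 \<subseteq> s \<and> s \<subseteq> P}"
  have "\<exists>s\<in>F. \<forall>s'\<in>F. s \<subseteq> s' \<longrightarrow> s' = s"
  proof (rule subset_Zorn_nonempty)
    show "F \<noteq> {}" using assms by (auto simp: F_def)
    fix C assume C: "C \<noteq> {}" "subset.chain F C"
    then have CF: "C \<subseteq> F" by (simp add: subset_chain_def)
    have "opn (npower A n) f xs \<in> \<Union>C"
      if f: "f \<in> opsyms (sig (npower A n))" and xs: "xs \<in> tuples (\<Union>C) (opar (sig (npower A n)) f)"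
      for f xs
    proof -
      \<comment> \<open>Finitely many arguments from the union of a non-empty chain already lie in
        one member.\<close>
      have "finite (set xs)" "set xs \<subseteq> \<Union>C" using xs by (auto simp: tuples_def)
      then obtain s where s: "s \<in> C" "set xs \<subseteq> s" by (rule finite_subset_Union_chain[OF _ _ C])
      then have "xs \<in> tuples s (opar (sig (npower A n)) f)" using xs by (simp add: tuples_def)
      moreover have "subuniverse (npower A n) s" using s(1) CF by (auto simp: F_def)
      ultimately show ?thesis using s(1) f unfolding subuniverse_def by blast
    qed
    moreover have "\<Union>C \<subseteq> carrier (npower A n)"
      using CF by (auto simp: F_def subuniverse_def)
    ultimately have "subuniverse (npower A n) (\<Union>C)" unfolding subuniverse_def by blast
    then show "\<Union>C \<in> F" using CF C(1) by (auto simp: F_def)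
  qed
  then obtain s where "s \<in> F" "\<forall>s'\<in>F. s \<subseteq> s' \<longrightarrow> s' = s" by blast
  then have s: "subuniverse (npower A n) s" "s0 \<subseteq> s" "s \<subseteq> P"
    and mx: "\<And>s'. subuniverse (npower A n) s' \<Longrightarrow> s0 \<subseteq> s' \<Longrightarrow> s' \<subseteq> P \<Longrightarrow> s \<subseteq> s' \<Longrightarrow> s' = s"
    by (simp_all add: F_def)
  have "maximal_sub A n P s"
    unfolding maximal_sub_def using s mx order_trans[OF s(2)] by blast
  then show thesis using that s(2) by blast
qed

text \<open>The maps in \<open>\<alpha>s\<close> combine to one homomorphism from \<open>X\<close>
  to the power of \<open>A\<close>, and its image is closed under the operations.\<close>

lemma subuniverse_joint_image:
  assumes "is_struct X" and "sig X = sig A" and \<alpha>s: "\<alpha>s \<in> tuples (hom X A) n"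
  shows "subuniverse (npower A n) ((\<lambda>x. map (\<lambda>\<alpha>. \<alpha> x) \<alpha>s) ` carrier X)"
proof -
  let ?F = "\<lambda>x. map (\<lambda>\<alpha>. \<alpha> x) \<alpha>s"
  have \<alpha>: "\<alpha> \<in> hom X A" if "\<alpha> \<in> set \<alpha>s" for \<alpha> using that \<alpha>s by (auto simp: tuples_def)
  have len: "length \<alpha>s = n" using \<alpha>s by (simp add: tuples_def)
  have np: "sig (npower A n) = sig A" "carrier (npower A n) = tuples (carrier A) n"
    by (simp_all add: npower_def)
  show ?thesis
    unfolding subuniverse_def np
  proof (intro conjI ballI)
    show "?F ` carrier X \<subseteq> tuples (carrier A) n"
      using len homD_carrier[OF \<alpha>] by (auto simp: tuples_def)
    fix f yss assume f: "f \<in> opsyms (sig A)" and "yss \<in> tuples (?F ` carrier X) (opar (sig A) f)"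
    then obtain xs where xs: "xs \<in> tuples (carrier X) (opar (sig X) f)" and yss: "yss = map ?F xs"
      unfolding tuples_image assms(2) by blast
    have "opn (npower A n) f yss = ?F (opn X f xs)"
      using len \<alpha> homD_opn[of _ X A f xs] f xs assms(2)
      by (intro nth_equalityI) (auto simp: npower_def yss comp_def)
    moreover have "opn X f xs \<in> carrier X"
      using is_structD_opn[OF assms(1) _ xs] f assms(2) by simp
    ultimately show "opn (npower A n) f yss \<in> ?F ` carrier X" by (rule image_eqI)
  qed
qed

text \<open>Entailment speaks of substructures only, while \<open>P\<close> may fail to be one. The
  joint image of \<open>\<alpha>s\<close> is a substructure inside \<open>P\<close>; enlarged to a
  maximal \<open>s\<close>, it falls under entailment, and \<open>u\<close> keeps the tuple in
  \<open>s\<close> and so in \<open>P\<close>.\<close>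

lemma entails_maximal_preserves:
  fixes X :: "('x, 'f, 'r) topstruct"
  assumes Mt: "total_topstruct Mt" and X: "X \<in> IScP Mt" and u: "u \<in> hom (Edual M Mt X) M"
    and ent: "\<And>s. maximal_sub Mt n P s \<Longrightarrow> entails TYPE('x) M Mt n s"
    and \<alpha>s: "\<alpha>s \<in> tuples (chom X Mt) n"
    and P: "\<And>x. x \<in> carrier X \<Longrightarrow> map (\<lambda>\<alpha>. \<alpha> x) \<alpha>s \<in> P"
  shows "map u \<alpha>s \<in> P"
proof -
  have "\<alpha>s \<in> tuples (hom X Mt) n" using \<alpha>s by (auto simp: tuples_def chom_def)
  from subuniverse_joint_image[OF IScPD(2,1)[OF X Mt] this]
  obtain s where s: "(\<lambda>x. map (\<lambda>\<alpha>. \<alpha> x) \<alpha>s) ` carrier X \<subseteq> s" "maximal_sub Mt n P s"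
    using maximal_sub_exists P by (metis image_subsetI)
  have "map u \<alpha>s \<in> s"
    using ent[OF s(2)] X u \<alpha>s s(1) unfolding entails_def by blast
  then show ?thesis using s(2) by (auto simp: maximal_sub_def)
qed


section \<open>Piggybacking\<close>

lemma isomorphism_id:
  assumes "is_struct A"
  shows "isomorphism A A (\<lambda>a\<in>carrier A. a)" (is "isomorphism A A ?i")
proof -
  have i: "map ?i xs = xs" if "xs \<in> tuples (carrier A) n" for xs n
    using that by (auto simp: tuples_def subset_iff intro!: map_idI)
  have "?i \<in> hom A A"
    unfolding hom_def mem_Collect_eq
  proof (intro conjI ballI)
    show "?i (opn A f xs) = opn A f (map ?i xs)"
      if "f \<in> opsyms (sig A)" "xs \<in> tuples (carrier A) (opar (sig A) f)" for f xs
      unfolding i[OF that(2)] using is_structD_opn[OF assms that] by simp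
    show "map ?i xs \<in> rel A r" if "r \<in> relsyms (sig A)" "xs \<in> rel A r" for r xs
      unfolding i[OF is_structD_rel[OF assms that]] by (rule that(2))
  qed simp
  then show ?thesis unfolding isomorphism_def by (auto intro!: bexI[of _ ?i])
qed

lemma is_struct_substr:
  "subuniverse (power_str N S) C \<Longrightarrow> is_struct (substr (power_str N S) C)"
  unfolding is_struct_def subuniverse_def by (auto simp: substr_def power_str_def tuples_def)

text \<open>\<open>ISP_any_exponent\<close> admits an arbitrary exponent \<open>S\<close> here,
  whereas \<open>ISP\<close> prescribes a set of maps from the structure to the generator.\<close>

lemma substr_power_ISP:
  fixes N :: "('n, 'f, 'r) relstruct" and S :: "'i set"
  assumes "C \<noteq> {}" and "subuniverse (power_str N S) C"
  shows "substr (power_str N S) C \<in> ISP N"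
  using ISP_any_exponent[OF _ is_struct_substr[OF assms(2)] assms
      isomorphism_id[OF is_struct_substr[OF assms(2)]]]
  by (simp add: substr_simps power_str_simps)

text \<open>Injectivity of \<open>N\<close> extends \<phi> from \<open>W\<close> to the whole dual
  of \<open>Y\<close>, and co-duality of \<open>N\<close> says that the extension is evaluation at a
  point of \<open>Y\<close>.\<close>

lemma partial_hom_is_evaluation:
  fixes N :: "('n, 'g1, 'q1) relstruct" and Nt :: "('n, 'g2, 'q2) topstruct"
    and Y :: "('x, 'g2, 'q2) topstruct"
  assumes N: "is_struct N" and Nt: "total_topstruct Nt" and ego: "alter_ego N Nt"
    and cod: "co_dualises TYPE('x) Nt N" and inj: "injective_ISP TYPE('x \<Rightarrow> 'n) N"
    and Y: "Y \<in> IScP Nt"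
    and W: "W \<noteq> {}" "subuniverse (Edual N Nt Y) W"
    and \<phi>: "\<phi> \<in> hom (substr (Edual N Nt Y) W) N"
  shows "\<exists>y\<in>carrier Y. \<forall>w\<in>W. \<phi> w = w y"
proof -
  note YD = IScPD[OF Y Nt]
  let ?P = "power_str N (carrier Y)" and ?C = "chom Y Nt" and ?E = "Edual N Nt Y"
  have car: "carrier Nt = carrier N" using ego by (simp add: alter_ego_def)
  have C: "subuniverse ?P ?C"
    unfolding subuniverse_def power_str_simps
  proof (intro conjI ballI)
    show "?C \<subseteq> carrier Y \<rightarrow>\<^sub>E carrier N" using car by (auto simp: chom_def hom_def)
    show "opn ?P f \<alpha>s \<in> ?C" if "f \<in> opsyms (sig N)" "\<alpha>s \<in> tuples ?C (opar (sig N) f)" for f \<alpha>s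
      using opn_in_chom[OF N ego YD(1-3) that] by (simp add: power_str_def)
  qed
  have WC: "W \<subseteq> ?C" using W(2) by (simp add: subuniverse_def Edual_simps)
  have PW: "subuniverse ?P W"
    using W(2) WC C unfolding subuniverse_def Edual_def substr_simps by blast
  have "set xs \<subseteq> ?C \<and> set xs \<subseteq> W \<longleftrightarrow> set xs \<subseteq> W" for xs :: "('x \<Rightarrow> 'n) list"
    using WC by blast
  \<comment> \<open>Restricting relations first to \<open>chom Y Nt\<close> and then to
    \<open>W\<close> is the same as restricting once, so \<open>W\<close> carries the same structure
    inside the dual and inside the power.\<close>
  then have EW: "substr ?E W = substr ?P W" by (simp add: Edual_def substr_def)
  have isp: "substr ?P W \<in> ISP N" "?E \<in> ISP N"
    unfolding Edual_def using substr_power_ISP W(1) PW C YD(5) by blast+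
  let ?i = "\<lambda>w\<in>W. w"
  have "isomorphism (substr ?P W) (substr ?E W) ?i"
    unfolding EW using isomorphism_id[OF is_struct_substr[OF PW]] by (simp add: substr_simps)
  then have emb: "embedding (substr ?P W) ?E ?i"
    unfolding embedding_def using W by blast
  obtain \<psi> where \<psi>: "\<psi> \<in> hom ?E N" "\<forall>w\<in>carrier (substr ?P W). \<psi> (?i w) = \<phi> w"
    using inj isp emb \<phi> unfolding injective_ISP_def EW by blast
  have "top_isomorphism Y (Dual N Nt ?E) (\<lambda>y\<in>carrier Y. \<lambda>\<alpha>\<in>?C. \<alpha> y)"
    using cod Y unfolding co_dualises_def by blast
  moreover have "\<psi> \<in> carrier (Dual N Nt ?E)" using \<psi>(1) by (simp add: Dual_simps)
  \<comment> \<open>The inverse of the evaluation isomorphism sends the extension \<psi> to the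
    point sought.\<close>
  ultimately obtain k where k: "k \<in> hom (Dual N Nt ?E) Y" "(\<lambda>y\<in>carrier Y. \<lambda>\<alpha>\<in>?C. \<alpha> y) (k \<psi>) = \<psi>"
    unfolding top_isomorphism_def chom_def by blast
  have y: "k \<psi> \<in> carrier Y" using homD_carrier[OF k(1)] \<psi>(1) by (simp add: Dual_simps)
  have "\<phi> w = w (k \<psi>)" if "w \<in> W" for w
  proof -
    have "\<psi> w = (\<lambda>y\<in>carrier Y. \<lambda>\<alpha>\<in>?C. \<alpha> y) (k \<psi>) w" using k(2) by simp
    then show ?thesis using y that WC \<psi>(2) by (auto simp: substr_simps)
  qed
  with y show ?thesis by blast
qed

section \<open>The map induced on the composites \<omega> \<circ> \<alpha> and its extension to an
  evaluation\<close>

lemma Clo1E: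
  assumes "t \<in> Clo1 A"
  obtains s where "wf_trm (sig A) 1 s" and "\<And>a. a \<in> carrier A \<Longrightarrow> t a = eval_trm A [a] s"
  using assms by (fastforce simp: Clo1_def term_functions_def tuples_def)

text \<open>A pair (\<omega>, \<alpha>) stands for the composite \<omega> \<circ> \<alpha>. The
  assumptions \<open>wd\<close>, \<open>ops\<close> and \<open>rels\<close> are what is required for
  \<omega> \<circ> \<alpha> \<mapsto> \<omega>(u(\<alpha>)) to be a well-defined homomorphism on a
  substructure of the dual of the reduct of \<open>X\<close>.\<close>

lemma piggyback_evaluation:
  fixes M :: "('m, 'f1, 'r1) relstruct" and Mt :: "('m, 'f2, 'r2) topstruct"
    and N :: "('n, 'g1, 'q1) relstruct" and Nt :: "('n, 'g2, 'q2) topstruct"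
    and Mtb :: "('m, 'g2, 'q2) topstruct" and X :: "('x, 'f2, 'r2) topstruct"
  assumes M: "is_struct M" and Mt: "total_topstruct Mt" and egoM: "alter_ego M Mt"
    and N: "is_struct N" and Nt: "total_topstruct Nt" and egoN: "alter_ego N Nt"
    and cod: "co_dualises TYPE('x) Nt N" and inj: "injective_ISP TYPE('x \<Rightarrow> 'n) N"
    and red: "structural_reduct Mt Mtb" "topol Mtb = topol Mt" "Mtb \<in> IScP Nt"
    and \<Omega>: "\<Omega> \<subseteq> chom Mtb Nt" "\<Omega> \<noteq> {}"
    and sep: "separates_points (comp_maps \<Omega> (Clo1 M)) (carrier M)"
    and X: "X \<in> IScP Mt" and u: "u \<in> hom (Edual M Mt X) M"
    and wd: "\<And>p q. p \<in> \<Omega> \<times> chom X Mt \<Longrightarrow> q \<in> \<Omega> \<times> chom X Mt \<Longrightarrow>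
        (\<And>x. x \<in> carrier X \<Longrightarrow> fst p (snd p x) = fst q (snd q x)) \<Longrightarrow>
        fst p (u (snd p)) = fst q (u (snd q))"
    and ops: "\<And>g ps. g \<in> opsyms (sig N) \<Longrightarrow> ps \<in> tuples (\<Omega> \<times> chom X Mt) (opar (sig N) g) \<Longrightarrow>
        \<exists>q\<in>\<Omega> \<times> chom X Mt.
          (\<forall>x\<in>carrier X. fst q (snd q x) = opn N g (map (\<lambda>p. fst p (snd p x)) ps)) \<and>
          fst q (u (snd q)) = opn N g (map (\<lambda>p. fst p (u (snd p))) ps)"
    and rels: "\<And>r ps. r \<in> relsyms (sig N) \<Longrightarrow> ps \<in> tuples (\<Omega> \<times> chom X Mt) (relar (sig N) r) \<Longrightarrow>
        (\<And>x. x \<in> carrier X \<Longrightarrow> map (\<lambda>p. fst p (snd p x)) ps \<in> rel N r) \<Longrightarrow>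
        map (\<lambda>p. fst p (u (snd p))) ps \<in> rel N r"
  shows "\<exists>x\<in>carrier X. \<forall>\<alpha>\<in>chom X Mt. u \<alpha> = \<alpha> x"
proof -
  note XD = IScPD[OF X Mt]
  have carM: "carrier Mt = carrier M" using egoM by (simp add: alter_ego_def)
  have carN: "carrier Nt = carrier N" using egoN by (simp add: alter_ego_def)
  obtain \<tau> \<Phi> where pres: "presents Mt Mtb \<tau> \<Phi>" using structural_reduct_presents[OF red(1)] .
  define Y where "Y = reduct_str X (sig Mtb) \<tau> \<Phi>"
  have Y: "Y \<in> IScP Nt" using reduct_str_IScP[OF Mt Nt pres red(2,3) X] by (simp add: Y_def)
  have carY: "carrier Y = carrier X" by (simp add: Y_def reduct_str_simps)
  let ?Q = "\<Omega> \<times> chom X Mt"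
  \<comment> \<open>\<open>c p\<close> is the composite coded by \<open>p\<close>, and
    \<open>v p\<close> is the value that the induced map is to take there.\<close>
  define c where "c p = (\<lambda>x\<in>carrier X. fst p (snd p x))" for p :: "('m \<Rightarrow> 'n) \<times> ('x \<Rightarrow> 'm)"
  define v :: "('m \<Rightarrow> 'n) \<times> ('x \<Rightarrow> 'm) \<Rightarrow> 'n" where "v = (\<lambda>p. fst p (u (snd p)))"
  define W where "W = c ` ?Q"
  \<comment> \<open>\<open>inv_into\<close> picks some pair coding \<open>w\<close>; by
    \<open>wd\<close> the value does not depend on the choice, which is the content of
    \<open>\<phi>c\<close>.\<close>
  define \<phi> where "\<phi> = (\<lambda>w\<in>W. v (inv_into ?Q c w))"
  have WY: "W \<subseteq> chom Y Nt"
  proof -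
    have "c p \<in> chom Y Nt" if p: "p \<in> ?Q" for p
    proof -
      have "snd p \<in> chom Y Mtb"
        unfolding Y_def using chom_reduct_str[OF pres red(2) XD(1,2)] p by auto
      moreover have "fst p \<in> chom Mtb Nt" using p \<Omega>(1) by auto
      moreover have "sig Y = sig Mtb" by (simp add: Y_def reduct_str_simps)
      ultimately have "(\<lambda>x\<in>carrier Y. fst p (snd p x)) \<in> chom Y Nt"
        using IScPD(2,3)[OF Y Nt] by (intro chom_compose)
      then show ?thesis by (simp add: c_def carY)
    qed
    then show ?thesis by (auto simp: W_def)
  qed
  have \<phi>c: "\<phi> (c p) = v p" if p: "p \<in> ?Q" for p
  proof -
    have cW: "c p \<in> c ` ?Q" using p by (rule imageI)
    define q where "q = inv_into ?Q c (c p)"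
    have q: "q \<in> ?Q" "c q = c p"
      unfolding q_def using inv_into_into[OF cW] f_inv_into_f[OF cW] by auto
    have "v q = v p"
      unfolding v_def
    proof (rule wd[OF q(1) p])
      show "fst q (snd q x) = fst p (snd p x)" if "x \<in> carrier X" for x
        using fun_cong[OF q(2), of x] that by (simp add: c_def)
    qed
    then show ?thesis using cW by (simp add: \<phi>_def W_def q_def)
  qed
  have tW: "tuples W n = map c ` tuples ?Q n" for n by (simp add: W_def tuples_image)
  have atx: "map (\<lambda>w. w x) (map c ps) = map (\<lambda>p. fst p (snd p x)) ps" if "x \<in> carrier X" for x ps
    using that by (simp add: c_def)
  have m\<phi>: "map \<phi> (map c ps) = map v ps" if "ps \<in> tuples ?Q n" for ps n
    using that \<phi>c by (auto simp: tuples_def subset_iff)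
  let ?E = "Edual N Nt Y"
  \<comment> \<open>One witness \<open>q\<close> gives both that the composites are closed under
    \<open>g\<close> and that \<phi> commutes with \<open>g\<close>.\<close>
  have op: "\<exists>q\<in>?Q. opn ?E g (map c ps) = c q \<and> v q = opn N g (map v ps)"
    if g: "g \<in> opsyms (sig N)" and ps: "ps \<in> tuples ?Q (opar (sig N) g)" for g ps
  proof -
    obtain q where q: "q \<in> ?Q"
      "\<forall>x\<in>carrier X. fst q (snd q x) = opn N g (map (\<lambda>p. fst p (snd p x)) ps)"
      "v q = opn N g (map v ps)"
      using ops[OF g ps] by (elim bexE conjE) (rule that, simp_all add: v_def)
    have "opn ?E g (map c ps) = (\<lambda>x\<in>carrier X. opn N g (map (\<lambda>w. w x) (map c ps)))"
      by (simp only: Edual_simps carY)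
    also have "\<dots> = c q"
      unfolding c_def[of q] by (rule restrict_ext) (simp only: atx q(2))
    finally show ?thesis using q(1,3) by blast
  qed
  have W: "subuniverse ?E W"
    unfolding subuniverse_def Edual_simps(1,2)
  proof (intro conjI ballI)
    fix g ws assume g: "g \<in> opsyms (sig N)" and "ws \<in> tuples W (opar (sig N) g)"
    then obtain ps where ps: "ps \<in> tuples ?Q (opar (sig N) g)" "ws = map c ps"
      unfolding tW by blast
    then show "opn ?E g ws \<in> W" using op[OF g ps(1)] unfolding W_def by auto
  qed (rule WY)
  have vN: "v p \<in> carrier N" if "p \<in> ?Q" for p
  proof -
    have "u (snd p) \<in> carrier Mtb"
      using homD_carrier[OF u] that carM pres by (auto simp: Edual_simps presents_def)
    moreover have "fst p \<in> hom Mtb Nt" using that \<Omega>(1) by (auto simp: chom_def)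
    ultimately have "fst p (u (snd p)) \<in> carrier Nt" by (rule homD_carrier[rotated])
    then show ?thesis using carN by (simp add: v_def)
  qed
  have "\<phi> \<in> hom (substr ?E W) N"
    unfolding hom_def mem_Collect_eq substr_simps(1-3) Edual_simps(1)
  proof (intro conjI ballI)
    have "\<phi> w \<in> carrier N" if w: "w \<in> W" for w
    proof -
      obtain p where "p \<in> ?Q" "w = c p" using w unfolding W_def by (rule imageE)
      then show ?thesis using \<phi>c vN by simp
    qed
    then show "\<phi> \<in> W \<rightarrow>\<^sub>E carrier N" by (auto simp: \<phi>_def)
  next
    fix g ws assume g: "g \<in> opsyms (sig N)" and "ws \<in> tuples W (opar (sig N) g)"
    then obtain ps where ps: "ps \<in> tuples ?Q (opar (sig N) g)" "ws = map c ps"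
      unfolding tW by blast
    obtain q where q: "q \<in> ?Q" "opn ?E g (map c ps) = c q" "v q = opn N g (map v ps)"
      using op[OF g ps(1)] by blast
    show "\<phi> (opn ?E g ws) = opn N g (map \<phi> ws)"
      by (simp only: ps(2) q(2,3) \<phi>c[OF q(1)] m\<phi>[OF ps(1)])
  next
    fix r ws assume r: "r \<in> relsyms (sig N)" and ws: "ws \<in> rel (substr ?E W) r"
    then have wsE: "ws \<in> rel ?E r" and "set ws \<subseteq> W" by (simp_all add: substr_simps)
    moreover have "length ws = relar (sig N) r"
      using wsE by (simp add: Edual_def substr_def power_str_def tuples_def)
    ultimately have wsW: "ws \<in> tuples W (relar (sig N) r)" by (simp add: tuples_def)
    then obtain ps where ps: "ps \<in> tuples ?Q (relar (sig N) r)" "ws = map c ps"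
      unfolding tW by blast
    have "ws \<in> tuples (chom Y Nt) (relar (sig N) r)" using wsW WY by (auto simp: tuples_def)
    then have "map (\<lambda>w. w x) ws \<in> rel N r" if "x \<in> carrier X" for x
      using Edual_rel[OF carN, of ws Y r] wsE that by (simp add: carY)
    then have "map (\<lambda>p. fst p (snd p x)) ps \<in> rel N r" if "x \<in> carrier X" for x
      unfolding atx[OF that, symmetric] ps(2) using that .
    from rels[OF r ps(1) this] show "map \<phi> ws \<in> rel N r"
      unfolding ps(2) m\<phi>[OF ps(1)] by (simp add: v_def)
  qed
  moreover have "W \<noteq> {}" using \<Omega>(2) XD(5) by (auto simp: W_def)
  ultimately obtain x where x: "x \<in> carrier X" "\<forall>w\<in>W. \<phi> w = w x"
    using partial_hom_is_evaluation[OF N Nt egoN cod inj Y _ W, of \<phi>] unfolding carY by blast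
  \<comment> \<open>So far \<open>u\<close> agrees with evaluation at \<open>x\<close> only after
    composing with members of \<Omega>. The unary terms of \<open>M\<close> serve to remove
    \<omega>.\<close>
  have vx: "\<omega> (u \<beta>) = \<omega> (\<beta> x)" if "\<omega> \<in> \<Omega>" "\<beta> \<in> chom X Mt" for \<omega> \<beta>
  proof -
    have p: "(\<omega>, \<beta>) \<in> ?Q" using that by simp
    then have "\<phi> (c (\<omega>, \<beta>)) = c (\<omega>, \<beta>) x" using x(2) by (simp add: W_def)
    then show ?thesis using \<phi>c[OF p] x(1) by (simp add: c_def v_def)
  qed
  have cl: "opn (Edual M Mt X) f \<alpha>s \<in> chom X Mt"
    if "f \<in> opsyms (sig M)" "\<alpha>s \<in> tuples (chom X Mt) (opar (sig M) f)" for f \<alpha>s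
    using opn_in_chom[OF M egoM XD(1-3) that] by (simp add: Edual_simps)
  have strE: "is_struct (Edual M Mt X)" using is_struct_Edual[OF cl] .
  have e: "(\<lambda>\<alpha>\<in>chom X Mt. \<alpha> x) \<in> hom (Edual M Mt X) M"
    using evaluation_hom[OF carM x(1) cl] .
  have "u \<alpha> = \<alpha> x" if \<alpha>: "\<alpha> \<in> chom X Mt" for \<alpha>
  proof (rule ccontr)
    assume ne: "u \<alpha> \<noteq> \<alpha> x"
    have u\<alpha>: "u \<alpha> \<in> carrier M" using homD_carrier[OF u] \<alpha> by (simp add: Edual_simps)
    moreover have \<alpha>x: "\<alpha> x \<in> carrier M" using homD_carrier[OF _ x(1)] \<alpha> carM by (auto simp: chom_def)
    ultimately obtain \<omega> t where t: "\<omega> \<in> \<Omega>" "t \<in> Clo1 M" "\<omega> (t (u \<alpha>)) \<noteq> \<omega> (t (\<alpha> x))"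
      using sep ne unfolding separates_points_def comp_maps_def by fastforce
    obtain s where s: "wf_trm (sig M) 1 s" "\<And>a. a \<in> carrier M \<Longrightarrow> t a = eval_trm M [a] s"
      using Clo1E[OF t(2)] by blast
    \<comment> \<open>The term \<open>s\<close> that induces \<open>t\<close> is applied to \<alpha>
      inside the dual of \<open>X\<close>. Both \<open>u\<close> and evaluation at \<open>x\<close>
      commute with it, so \<open>vx\<close> at \<beta> contradicts the separation of
      \<open>u \<alpha>\<close> from \<open>\<alpha> x\<close> by \<omega> \<circ> t.\<close>
    define \<beta> where "\<beta> = eval_trm (Edual M Mt X) [\<alpha>] s"
    have \<alpha>1: "[\<alpha>] \<in> tuples (carrier (Edual M Mt X)) 1" using \<alpha> by (simp add: tuples_def Edual_simps)
    have s1: "wf_trm (sig (Edual M Mt X)) 1 s" using s(1) by (simp add: Edual_simps)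
    have \<beta>: "\<beta> \<in> chom X Mt"
      using eval_trm_in_carrier[OF strE \<alpha>1 s1] by (simp add: \<beta>_def Edual_simps)
    have "u \<beta> = t (u \<alpha>)"
      using hom_eval_trm[OF u strE \<alpha>1 s1] s(2)[OF u\<alpha>] by (simp add: \<beta>_def)
    moreover have "\<beta> x = t (\<alpha> x)"
      using hom_eval_trm[OF e strE \<alpha>1 s1] s(2)[OF \<alpha>x] \<alpha> \<beta> by (simp add: \<beta>_def)
    ultimately show False using vx[OF t(1) \<beta>] t(3) by simp
  qed
  with x(1) show ?thesis by blast
qed

text \<open>The term defining \<open>g\<close> in the reduct of \<open>M\<close> is evaluated in
  \<open>E\<close> to produce \<beta>. As every homomorphism commutes with terms, one \<beta> serves
  all \<open>v\<close> at once; this uniformity is needed to treat \<open>u\<close> and the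
  evaluations together.\<close>

lemma operation_through_reduct:
  assumes red: "structural_reduct M Mb" and sg: "sig Mb = sig N" and \<omega>: "\<omega> \<in> hom Mb N"
    and strE: "is_struct E" and sgE: "sig E = sig M"
    and g: "g \<in> opsyms (sig N)" and \<alpha>s: "\<alpha>s \<in> tuples (carrier E) (opar (sig N) g)"
  shows "\<exists>\<beta>\<in>carrier E. \<forall>v\<in>hom E M. \<omega> (v \<beta>) = opn N g (map (\<lambda>\<alpha>. \<omega> (v \<alpha>)) \<alpha>s)"
proof -
  obtain \<tau> \<Phi> where pres: "presents M Mb \<tau> \<Phi>" using structural_reduct_presents[OF red] .
  have wf: "wf_trm (sig E) (opar (sig N) g) (\<tau> g)" using pres g sg sgE by (simp add: presents_def)
  show ?thesis
  proof (intro bexI ballI)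
    show "eval_trm E \<alpha>s (\<tau> g) \<in> carrier E" using eval_trm_in_carrier[OF strE \<alpha>s wf] .
    fix v assume v: "v \<in> hom E M"
    have mv: "map v \<alpha>s \<in> tuples (carrier M) (opar (sig N) g)"
      using map_in_tuples[OF \<alpha>s homD_carrier[OF v]] .
    have "v (eval_trm E \<alpha>s (\<tau> g)) = opn Mb g (map v \<alpha>s)"
      using hom_eval_trm[OF v strE \<alpha>s wf] pres g sg mv by (simp add: presents_def)
    also have "\<omega> \<dots> = opn N g (map \<omega> (map v \<alpha>s))"
      using homD_opn[OF \<omega>, of g "map v \<alpha>s"] g sg mv pres by (simp add: presents_def)
    finally show "\<omega> (v (eval_trm E \<alpha>s (\<tau> g))) = opn N g (map (\<lambda>\<alpha>. \<omega> (v \<alpha>)) \<alpha>s)"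
      by (simp add: comp_def)
  qed
qed

text \<open>The pairs split into a list of maps \<omega> and a list of morphisms \<alpha>. The
  pointwise condition says that the joint image of the latter lies in the preimage of
  \<open>r\<close> under the former, where \<open>entails_maximal_preserves\<close> applies.\<close>

lemma entailed_preimage_preserved:
  fixes X :: "('x, 'f2, 'r2) topstruct" and Mt :: "('m, 'f2, 'r2) topstruct"
  assumes Mt: "total_topstruct Mt" and car: "carrier Mt = carrier M"
    and X: "X \<in> IScP Mt" and u: "u \<in> hom (Edual M Mt X) M"
    and ent: "\<And>s. s \<in> max_rels Mt \<Omega> n r \<Longrightarrow> entails TYPE('x) M Mt n s"
    and ps: "ps \<in> tuples (\<Omega> \<times> chom X Mt) n"
    and r: "\<And>x. x \<in> carrier X \<Longrightarrow> map (\<lambda>p. fst p (snd p x)) ps \<in> r"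
  shows "map (\<lambda>p. fst p (u (snd p))) ps \<in> r"
proof -
  let ?\<omega>s = "map fst ps" and ?\<alpha>s = "map snd ps"
  have m2: "map2 (\<lambda>\<omega> a. \<omega> a) ?\<omega>s (map F ?\<alpha>s) = map (\<lambda>p. fst p (F (snd p))) ps" for F
    by (rule nth_equalityI) auto
  have len: "length ps = n" using ps by (simp add: tuples_def)
  have \<alpha>s: "?\<alpha>s \<in> tuples (chom X Mt) n" using ps by (auto simp: tuples_def)
  have "map u ?\<alpha>s \<in> rel_preimage (carrier Mt) ?\<omega>s r"
  proof (rule entails_maximal_preserves[OF Mt X u _ \<alpha>s])
    fix s assume "maximal_sub Mt n (rel_preimage (carrier Mt) ?\<omega>s r) s"
    then show "entails TYPE('x) M Mt n s"
      using ps len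
      by (intro ent) (force simp: max_rels_def tuples_def intro!: exI[of _ ?\<omega>s])
  next
    fix x assume x: "x \<in> carrier X"
    have "map (\<lambda>\<alpha>. \<alpha> x) ?\<alpha>s \<in> tuples (carrier Mt) (length ?\<omega>s)"
      unfolding length_map len
    proof (rule map_in_tuples[OF \<alpha>s])
      show "\<alpha> x \<in> carrier Mt" if "\<alpha> \<in> chom X Mt" for \<alpha>
        using that homD_carrier[OF _ x] by (auto simp: chom_def)
    qed
    then show "map (\<lambda>\<alpha>. \<alpha> x) ?\<alpha>s \<in> rel_preimage (carrier Mt) ?\<omega>s r"
      unfolding rel_preimage_def mem_Collect_eq m2 using r[OF x] by simp
  qed
  then show ?thesis unfolding rel_preimage_def mem_Collect_eq m2 by simp
qed

text \<open>Morphisms commute with unary terms of \<open>Mt\<close>, so if \<omega> \<circ> \<alpha>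
  = \<omega> \<circ> \<beta>, then \<omega>(t(\<alpha>(x))) = \<omega>(\<alpha>(t(x))) =
  \<omega>(\<beta>(t(x))) = \<omega>(t(\<beta>(x))) for every such term t. Separation then forces
  \<alpha>(x) = \<beta>(x).\<close>

lemma clone_separation_cancels:
  fixes X :: "('x, 'f2, 'r2) topstruct" and Mt :: "('m, 'f2, 'r2) topstruct"
  assumes Mt: "total_topstruct Mt" and X: "X \<in> IScP Mt"
    and sep: "separates_points (comp_maps {\<omega>} (Clo1 Mt)) (carrier Mt)"
    and \<alpha>: "\<alpha> \<in> chom X Mt" and \<beta>: "\<beta> \<in> chom X Mt"
    and eq: "\<And>x. x \<in> carrier X \<Longrightarrow> \<omega> (\<alpha> x) = \<omega> (\<beta> x)"
  shows "\<alpha> = \<beta>"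
proof -
  note XD = IScPD[OF X Mt]
  have h: "\<alpha> \<in> hom X Mt" "\<beta> \<in> hom X Mt" using \<alpha> \<beta> by (simp_all add: chom_def)
  have "\<alpha> x = \<beta> x" if x: "x \<in> carrier X" for x
  proof (rule ccontr)
    assume "\<alpha> x \<noteq> \<beta> x"
    then obtain t where t: "t \<in> Clo1 Mt" "\<omega> (t (\<alpha> x)) \<noteq> \<omega> (t (\<beta> x))"
      using sep homD_carrier[OF h(1) x] homD_carrier[OF h(2) x]
      unfolding separates_points_def comp_maps_def by fastforce
    obtain s where s: "wf_trm (sig Mt) 1 s" "\<And>a. a \<in> carrier Mt \<Longrightarrow> t a = eval_trm Mt [a] s"
      using Clo1E[OF t(1)] by blast
    have x1: "[x] \<in> tuples (carrier X) 1" and s1: "wf_trm (sig X) 1 s"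
      using x s(1) XD(1) by (simp_all add: tuples_def)
    have "t (\<gamma> x) = \<gamma> (eval_trm X [x] s)" if "\<gamma> \<in> hom X Mt" for \<gamma>
      using hom_eval_trm[OF that XD(2) x1 s1] s(2)[OF homD_carrier[OF that x]] by simp
    then show False using t(2) h eq[OF eval_trm_in_carrier[OF XD(2) x1 s1]] by simp
  qed
  then show ?thesis using h by (auto simp: hom_def intro: PiE_ext)
qed

text \<open>A common form of both alternatives. In \<open>ops\<close>, a singleton \<Omega> and
  arities at most one serve the same end: all arguments of an operation involve a single \<omega>.
  In \<open>kernels\<close>, either disjunct yields well-definedness of the induced map.\<close>

lemma piggyback_co_duality:
  fixes M :: "('m, 'f1, 'r1) relstruct" and Mt :: "('m, 'f2, 'r2) topstruct"
    and N :: "('n, 'g1, 'q1) relstruct" and Nt :: "('n, 'g2, 'q2) topstruct"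
    and Mtb :: "('m, 'g2, 'q2) topstruct" and \<Omega> :: "('m \<Rightarrow> 'n) set"
  assumes M: "is_struct M" and Mt: "total_topstruct Mt" and egoM: "alter_ego M Mt"
    and N: "is_struct N" and Nt: "total_topstruct Nt" and egoN: "alter_ego N Nt"
    and cod: "co_dualises TYPE('x) Nt N" and inj: "injective_ISP TYPE('x \<Rightarrow> 'n) N"
    and red: "structural_reduct Mt Mtb" "topol Mtb = topol Mt" "Mtb \<in> IScP Nt"
    and \<Omega>: "\<Omega> \<subseteq> chom Mtb Nt" "\<Omega> \<noteq> {}"
    and sep: "separates_points (comp_maps \<Omega> (Clo1 M)) (carrier M)"
    and ops: "purely_relational N \<or>
      (\<exists>Mb :: ('m, 'g1, 'q1) relstruct. structural_reduct M Mb \<and> sig Mb = sig N \<and> \<Omega> \<subseteq> hom Mb N \<and>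
         ((\<exists>\<omega>. \<Omega> = {\<omega>}) \<or> (\<forall>g\<in>opsyms (sig N). opar (sig N) g \<le> 1)))"
    and rels: "\<And>r s. r \<in> relsyms (sig N) \<Longrightarrow> s \<in> max_rels Mt \<Omega> (relar (sig N) r) (rel N r) \<Longrightarrow>
      entails TYPE('x) M Mt (relar (sig N) r) s"
    and kernels: "(\<forall>s\<in>max_rels Mt \<Omega> 2 (diagonal (carrier N)). entails TYPE('x) M Mt 2 s) \<or>
      (\<exists>\<omega>. \<Omega> = {\<omega>} \<and> separates_points (comp_maps {\<omega>} (Clo1 Mt)) (carrier M))"
  shows "co_dualises TYPE('x) Mt M"
  unfolding co_dualises_def
proof
  fix X :: "('x, 'f2, 'r2) topstruct"
  assume X: "X \<in> IScP Mt"
  note XD = IScPD[OF X Mt]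
  have car: "carrier Mt = carrier M" using egoM by (simp add: alter_ego_def)
  have carN: "carrier Nt = carrier N" using egoN by (simp add: alter_ego_def)
  have carb: "carrier Mtb = carrier M" using red(1) car by (simp add: structural_reduct_def)
  let ?E = "Edual M Mt X" and ?Q = "\<Omega> \<times> chom X Mt"
  have cl: "opn ?E f \<alpha>s \<in> chom X Mt"
    if "f \<in> opsyms (sig M)" "\<alpha>s \<in> tuples (chom X Mt) (opar (sig M) f)" for f \<alpha>s
    using opn_in_chom[OF M egoM XD(1-3) that] by (simp add: Edual_simps)
  have strE: "is_struct ?E" using is_struct_Edual[OF cl] .
  have e: "(\<lambda>\<alpha>\<in>chom X Mt. \<alpha> x) \<in> hom ?E M" if "x \<in> carrier X" for x
    using evaluation_hom[OF car that cl] .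
  show "top_isomorphism X (Dual M Mt ?E) (\<lambda>x\<in>carrier X. \<lambda>\<alpha>\<in>chom X Mt. \<alpha> x)"
  proof (rule top_isomorphism_evaluation[OF M Mt egoM X])
    fix u assume u: "u \<in> hom ?E M"
    show "\<exists>x\<in>carrier X. \<forall>\<alpha>\<in>chom X Mt. u \<alpha> = \<alpha> x"
    proof (rule piggyback_evaluation[OF M Mt egoM N Nt egoN cod inj red \<Omega> sep X u])
      fix p q assume p: "p \<in> ?Q" and q: "q \<in> ?Q"
        and eq: "\<And>x. x \<in> carrier X \<Longrightarrow> fst p (snd p x) = fst q (snd q x)"
      show "fst p (u (snd p)) = fst q (u (snd q))"
        using kernels
      proof
        assume "\<forall>s\<in>max_rels Mt \<Omega> 2 (diagonal (carrier N)). entails TYPE('x) M Mt 2 s"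
        then have ent: "entails TYPE('x) M Mt 2 s"
          if "s \<in> max_rels Mt \<Omega> 2 (diagonal (carrier N))" for s using that by blast
        \<comment> \<open>Equality of two composites means that their joint values lie on the
          diagonal, so well-definedness is preservation of the diagonal.\<close>
        have "[p, q] \<in> tuples ?Q 2" using p q by (simp add: tuples_def)
        moreover have "map (\<lambda>p. fst p (snd p x)) [p, q] \<in> diagonal (carrier N)"
          if x: "x \<in> carrier X" for x
        proof -
          have "snd p \<in> hom X Mt" using p by (auto simp: chom_def)
          then have "snd p x \<in> carrier Mtb" using homD_carrier[OF _ x] car carb by metis
          moreover have "fst p \<in> hom Mtb Nt" using p \<Omega>(1) by (auto simp: chom_def)
          ultimately have "fst p (snd p x) \<in> carrier Nt" by (rule homD_carrier[rotated])
          then show ?thesis using eq[OF x] carN by (auto simp: diagonal_def)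
        qed
        ultimately have "map (\<lambda>p. fst p (u (snd p))) [p, q] \<in> diagonal (carrier N)"
          by (intro entailed_preimage_preserved[OF Mt car X u ent])
        then show ?thesis by (auto simp: diagonal_def)
      next
        assume "\<exists>\<omega>. \<Omega> = {\<omega>} \<and> separates_points (comp_maps {\<omega>} (Clo1 Mt)) (carrier M)"
        then obtain \<omega> where \<omega>: "\<Omega> = {\<omega>}"
          "separates_points (comp_maps {\<omega>} (Clo1 Mt)) (carrier Mt)" using car by auto
        have "snd p = snd q"
          using p q eq \<omega>(1) by (intro clone_separation_cancels[OF Mt X \<omega>(2)]) auto
        then show ?thesis using p q \<omega>(1) by auto
      qed
    next
      fix g ps assume g: "g \<in> opsyms (sig N)" and ps: "ps \<in> tuples ?Q (opar (sig N) g)"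
      with ops obtain Mb :: "('m, 'g1, 'q1) relstruct"
        where Mb: "structural_reduct M Mb" "sig Mb = sig N" "\<Omega> \<subseteq> hom Mb N"
          and ar: "(\<exists>\<omega>. \<Omega> = {\<omega>}) \<or> opar (sig N) g \<le> 1"
        by (auto simp: purely_relational_def)
      \<comment> \<open>For a nullary operation the list is empty and any member of \<Omega> will
        do.\<close>
      obtain \<omega> where \<omega>: "\<omega> \<in> \<Omega>" "\<forall>p\<in>set ps. fst p = \<omega>"
      proof (cases ps)
        case Nil
        then show thesis using \<Omega>(2) that by auto
      next
        case (Cons p ps')
        then have "fst p \<in> \<Omega>" using ps by (auto simp: tuples_def)
        moreover have "\<forall>q\<in>set ps. fst q = fst p"
          using ar
        proof
          assume "\<exists>\<omega>. \<Omega> = {\<omega>}"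
          then obtain \<omega> where "\<Omega> = {\<omega>}" by blast
          moreover have "fst q \<in> \<Omega>" if "q \<in> set ps" for q using that ps by (auto simp: tuples_def)
          ultimately show ?thesis using Cons by auto
        next
          assume "opar (sig N) g \<le> 1"
          moreover have "length ps = opar (sig N) g" using ps by (simp add: tuples_def)
          ultimately have "ps' = []" using Cons by (cases ps') simp_all
          then show ?thesis using Cons by simp
        qed
        ultimately show thesis using that by blast
      qed
      have sgE: "sig ?E = sig M" by (simp add: Edual_simps)
      have \<alpha>s: "map snd ps \<in> tuples (carrier ?E) (opar (sig N) g)"
        using map_in_tuples[OF ps, of snd "chom X Mt"] by (auto simp: Edual_simps)
      have "\<omega> \<in> hom Mb N" using \<omega>(1) Mb(3) by blast
      from operation_through_reduct[OF Mb(1,2) this strE sgE g \<alpha>s]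
      obtain \<beta> where \<beta>: "\<beta> \<in> chom X Mt"
        "\<And>v. v \<in> hom ?E M \<Longrightarrow> \<omega> (v \<beta>) = opn N g (map (\<lambda>\<alpha>. \<omega> (v \<alpha>)) (map snd ps))"
        unfolding Edual_simps by blast
      have \<omega>m: "map (\<lambda>\<alpha>. \<omega> (v \<alpha>)) (map snd ps) = map (\<lambda>p. fst p (v (snd p))) ps" for v
        using \<omega>(2) by simp
      \<comment> \<open>The defining property of \<beta> is used twice: with \<open>v\<close> the
        evaluation at \<open>x\<close> here, and with \<open>v\<close> equal to \<open>u\<close>
        afterwards.\<close>
      have "\<omega> (\<beta> x) = opn N g (map (\<lambda>p. fst p (snd p x)) ps)" if x: "x \<in> carrier X" for x
      proof -
        have "\<omega> (\<beta> x) = opn N g (map (\<lambda>p. fst p ((\<lambda>\<alpha>\<in>chom X Mt. \<alpha> x) (snd p))) ps)"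
          using \<beta>(2)[OF e[OF x]] \<beta>(1) unfolding \<omega>m by simp
        also have "map (\<lambda>p. fst p ((\<lambda>\<alpha>\<in>chom X Mt. \<alpha> x) (snd p))) ps = map (\<lambda>p. fst p (snd p x)) ps"
          using ps by (auto simp: tuples_def)
        finally show ?thesis .
      qed
      moreover have "\<omega> (u \<beta>) = opn N g (map (\<lambda>p. fst p (u (snd p))) ps)"
        using \<beta>(2)[OF u] unfolding \<omega>m .
      ultimately show "\<exists>q\<in>?Q.
          (\<forall>x\<in>carrier X. fst q (snd q x) = opn N g (map (\<lambda>p. fst p (snd p x)) ps)) \<and>
          fst q (u (snd q)) = opn N g (map (\<lambda>p. fst p (u (snd p))) ps)"
        using \<omega>(1) \<beta>(1) by (intro bexI[of _ "(\<omega>, \<beta>)"]) simp_all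
    next
      fix r ps assume r: "r \<in> relsyms (sig N)" and ps: "ps \<in> tuples ?Q (relar (sig N) r)"
        and "\<And>x. x \<in> carrier X \<Longrightarrow> map (\<lambda>p. fst p (snd p x)) ps \<in> rel N r"
      then show "map (\<lambda>p. fst p (u (snd p))) ps \<in> rel N r"
        by (intro entailed_preimage_preserved[OF Mt car X u rels[OF r] ps])
    qed
  qed
qed

section \<open>Reduction of the two alternatives to the common criterion\<close>

theorem theorem3p5:
  fixes M :: "('m, 'f1, 'r1) relstruct"
    and Mt :: "('m, 'f2, 'r2) topstruct"
    and N :: "('n, 'g1, 'q1) relstruct"
    and Nt :: "('n, 'g2, 'q2) topstruct"
    and Mtb :: "('m, 'g2, 'q2) topstruct"
    and \<Omega> :: "('m \<Rightarrow> 'n) set"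
  assumes "total_structure M" and "nontrivial M"
    and "total_structure N" and "nontrivial N"
    and "total_topstruct Mt" and "alter_ego M Mt"
    and "total_topstruct Nt" and "alter_ego N Nt"
    and "fully_dualises TYPE('x \<Rightarrow> 'n) TYPE('x) Nt N"
    and "injective_IScP TYPE('x) Nt"
    and "injective_ISP TYPE('x \<Rightarrow> 'n) N"
    and "named_constants Mt"
    and "structural_reduct Mt Mtb" and "topol Mtb = topol Mt" and "Mtb \<in> IScP Nt"
    and "\<Omega> \<subseteq> chom Mtb Nt"
    and alternatives:
      "(\<exists>\<omega>. \<Omega> = {\<omega>} \<and>
          separates_structure (comp_maps {\<omega>} (Clo1 M)) Mtb Nt \<and>
          (purely_relational N \<or>
           (\<exists>Mb :: ('m, 'g1, 'q1) relstruct.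
              structural_reduct M Mb \<and> Mb \<in> ISP N \<and> \<omega> \<in> hom Mb N)) \<and>
          (operations_continuous Mt (topol Mt) \<and>
           (\<forall>r\<in>relsyms (sig N). \<forall>s\<in>max_rels Mt {\<omega>} (relar (sig N) r) (rel N r).
              entails TYPE('x) M Mt (relar (sig N) r) s)) \<and>
          ((\<forall>s. maximal_sub Mt 2 (ker_rel (carrier M) (carrier N) \<omega>) s \<longrightarrow>
              entails TYPE('x) M Mt 2 s) \<or>
           separates_points (comp_maps {\<omega>} (Clo1 Mt)) (carrier M)))
       \<or>
       (separates_structure (comp_maps \<Omega> (Clo1 M)) Mtb Nt \<and>
        (purely_relational N \<or>
         (\<exists>Mb :: ('m, 'g1, 'q1) relstruct.
            structural_reduct M Mb \<and> Mb \<in> ISP N \<and> (\<forall>\<omega>\<in>\<Omega>. \<omega> \<in> hom Mb N) \<and>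
            (\<forall>g\<in>opsyms (sig N). opar (sig N) g \<le> 1))) \<and>
        (operations_continuous Mt (topol Mt) \<and>
         (\<forall>r\<in>relsyms (sig N). \<forall>s\<in>max_rels Mt \<Omega> (relar (sig N) r) (rel N r).
            entails TYPE('x) M Mt (relar (sig N) r) s)) \<and>
        (\<forall>s\<in>max_rels Mt \<Omega> 2 (diagonal (carrier N)). entails TYPE('x) M Mt 2 s))"
  shows "co_dualises TYPE('x) Mt M"
proof -
  have M: "is_struct M" and N: "is_struct N" using assms(1,3) by (simp_all add: total_structure_def)
  have cod: "co_dualises TYPE('x) Nt N" using assms(9) by (simp add: fully_dualises_def)
  have car: "carrier Mt = carrier M" using assms(6) by (simp add: alter_ego_def)
  have carb: "carrier Mtb = carrier M"
    using assms(13) car by (simp add: structural_reduct_def)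
  have ispsig: "sig Mb = sig N" if "Mb \<in> ISP N" for Mb :: "('m, 'g1, 'q1) relstruct"
    using that by (simp add: ISP_def)
  note piggyback = piggyback_co_duality[OF M assms(5,6) N assms(7,8) cod assms(11,13-16)]
  \<comment> \<open>\<open>M\<close> has two distinct points and an empty \<Omega> could not
    separate them.\<close>
  have ne: "\<Omega> \<noteq> {}" if "separates_points (comp_maps \<Omega> (Clo1 M)) (carrier M)"
    using that assms(2) unfolding separates_points_def comp_maps_def nontrivial_def by blast
  show ?thesis
    using alternatives
  proof (rule disjE; (elim exE conjE)?)
    fix \<omega>
    assume \<Omega>: "\<Omega> = {\<omega>}"
      and sep: "separates_structure (comp_maps {\<omega>} (Clo1 M)) Mtb Nt"
      and ops: "purely_relational N \<or>
           (\<exists>Mb :: ('m, 'g1, 'q1) relstruct.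
              structural_reduct M Mb \<and> Mb \<in> ISP N \<and> \<omega> \<in> hom Mb N)"
      and rels: "\<forall>r\<in>relsyms (sig N). \<forall>s\<in>max_rels Mt {\<omega>} (relar (sig N) r) (rel N r).
              entails TYPE('x) M Mt (relar (sig N) r) s"
      and kernels: "(\<forall>s. maximal_sub Mt 2 (ker_rel (carrier M) (carrier N) \<omega>) s \<longrightarrow>
              entails TYPE('x) M Mt 2 s) \<or>
           separates_points (comp_maps {\<omega>} (Clo1 Mt)) (carrier M)"
    have sepp: "separates_points (comp_maps \<Omega> (Clo1 M)) (carrier M)"
      using sep \<Omega> carb by (simp add: separates_structure_def)
    \<comment> \<open>Over a singleton the only list of length two is
      \<open>[\<omega>, \<omega>]\<close>, so the maximal relations for the diagonal are those
      maximal in the kernel of \<omega>.\<close>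
    have max2: "maximal_sub Mt 2 (ker_rel (carrier M) (carrier N) \<omega>) s"
      if s: "s \<in> max_rels Mt {\<omega>} 2 (diagonal (carrier N))" for s
    proof -
      obtain \<omega>s where \<omega>s: "length \<omega>s = 2" "set \<omega>s \<subseteq> {\<omega>}"
        "maximal_sub Mt 2 (rel_preimage (carrier Mt) \<omega>s (diagonal (carrier N))) s"
        using s unfolding max_rels_def by blast
      then have "\<omega>s = replicate 2 \<omega>" by (metis replicate_eqI singletonD subsetD)
      then have "\<omega>s = [\<omega>, \<omega>]" by (simp add: numeral_2_eq_2)
      with \<omega>s(3) show ?thesis by (simp add: ker_rel_def car)
    qed
    show ?thesis
    proof (rule piggyback[OF ne[OF sepp] sepp])
      show "purely_relational N \<or>
        (\<exists>Mb :: ('m, 'g1, 'q1) relstruct. structural_reduct M Mb \<and> sig Mb = sig N \<and> \<Omega> \<subseteq> hom Mb N \<and>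
          ((\<exists>\<omega>. \<Omega> = {\<omega>}) \<or> (\<forall>g\<in>opsyms (sig N). opar (sig N) g \<le> 1)))"
        using ops ispsig \<Omega> by auto
      show "entails TYPE('x) M Mt (relar (sig N) r) s"
        if "r \<in> relsyms (sig N)" "s \<in> max_rels Mt \<Omega> (relar (sig N) r) (rel N r)" for r s
        using rels that \<Omega> by blast
      show "(\<forall>s\<in>max_rels Mt \<Omega> 2 (diagonal (carrier N)). entails TYPE('x) M Mt 2 s) \<or>
        (\<exists>\<omega>. \<Omega> = {\<omega>} \<and> separates_points (comp_maps {\<omega>} (Clo1 Mt)) (carrier M))"
        using kernels max2 \<Omega> by blast
    qed
  next
    assume sep: "separates_structure (comp_maps \<Omega> (Clo1 M)) Mtb Nt"
      and ops: "purely_relational N \<or>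
         (\<exists>Mb :: ('m, 'g1, 'q1) relstruct.
            structural_reduct M Mb \<and> Mb \<in> ISP N \<and> (\<forall>\<omega>\<in>\<Omega>. \<omega> \<in> hom Mb N) \<and>
            (\<forall>g\<in>opsyms (sig N). opar (sig N) g \<le> 1))"
      and rels: "\<forall>r\<in>relsyms (sig N). \<forall>s\<in>max_rels Mt \<Omega> (relar (sig N) r) (rel N r).
            entails TYPE('x) M Mt (relar (sig N) r) s"
      and kernels: "\<forall>s\<in>max_rels Mt \<Omega> 2 (diagonal (carrier N)). entails TYPE('x) M Mt 2 s"
    have sepp: "separates_points (comp_maps \<Omega> (Clo1 M)) (carrier M)"
      using sep carb by (simp add: separates_structure_def)
    show ?thesis
    proof (rule piggyback[OF ne[OF sepp] sepp])
      show "purely_relational N \<or>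
        (\<exists>Mb :: ('m, 'g1, 'q1) relstruct. structural_reduct M Mb \<and> sig Mb = sig N \<and> \<Omega> \<subseteq> hom Mb N \<and>
          ((\<exists>\<omega>. \<Omega> = {\<omega>}) \<or> (\<forall>g\<in>opsyms (sig N). opar (sig N) g \<le> 1)))"
        using ops ispsig by blast
      show "entails TYPE('x) M Mt (relar (sig N) r) s"
        if "r \<in> relsyms (sig N)" "s \<in> max_rels Mt \<Omega> (relar (sig N) r) (rel N r)" for r s
        using rels that by blast
    qed (use kernels in blast)
  qed
qed

end
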